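(* Let $L_n$ be the length of a random source-to-sink path in a random series-parallel network of size $n$ generated by the binary model, and let $\phi=\frac{\sqrt5-1}{2}$. Then \[ \mathbb{E}(L_n)=n\left(\frac{3+\sqrt5}{2\sqrt5}\binom{n+\frac{\sqrt5}{2}-\frac32}{n}-\frac{3-\sqrt5}{2\sqrt5}\binom{n-\frac{\sqrt5}{2}-\frac32}{n}\right)\sim\frac{1+\sqrt5}{2\sqrt5}\,\frac{n^{\phi}}{\Gamma(\phi+1)} . \] Moreover, as $n\to\infty$, $L_n/n^{\phi}\xrightarrow{(d)}L$, where $L$ is characterized by \[ \mathbb{E}(L^r)=\frac{r!\,c_r}{\Gamma(r\phi+1)},\quad r\ge0, \] with $c_0=1$, $c_1=\frac{3+\phi}{5}$ and \[ c_r=\frac{1}{(r-1)\phi((r+1)\phi+1)}\sum_{k=1}^{r-1}(k\phi+1)c_kc_{r-k},\quad r\ge2 . \]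
   Context: Binary model: a series-parallel network is a directed multigraph with a source and a sink; its size is its number of edges. At step $1$ it is a single edge from source to sink. At step $n\ge2$ one of the $n-1$ edges, say $(x,y)$, is chosen uniformly at random; if $x$ has out-degree $1$, an additional parallel edge $(x,y)$ is added; otherwise ($x$ has out-degree $2$) the edge $(x,y)$ is replaced by $(x,z),(z,y)$ with $z$ a new node. A random source-to-sink path starts at the source and at each node with two outgoing edges chooses one of them uniformly at random (independently), until the sink; its length is its number of edges. For real $x$, $\binom{x}{k}=x(x-1)\cdots(x-k+1)/k!$. *)

theory Defs
  imports
    "Graph_Theory.Arc_Walk"
    "HOL-Probability.Probability"
    "HOL-Library.Landau_Symbols"
begin

text \<open>
  A network is a directed multigraph whose nodes and arcs are named by natural numbers.
  All networks share the same source and sink, which are therefore constants.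
\<close>

type_synonym network = "(nat, nat) pre_digraph"

definition source :: nat where "source = 0"

definition sink :: nat where "sink = 1"

definition single_edge :: network where
  "single_edge = \<lparr>verts = {source, sink}, arcs = {0}, tail = (\<lambda>_. source), head = (\<lambda>_. sink)\<rparr>"

definition fresh :: "nat set \<Rightarrow> nat" where
  "fresh A = Suc (Max A)"

definition add_parallel :: "network \<Rightarrow> nat \<Rightarrow> network" where
  "add_parallel N e = (let f = fresh (arcs N) in
     N\<lparr>arcs := insert f (arcs N),
       tail := (tail N)(f := tail N e),
       head := (head N)(f := head N e)\<rparr>)"

text \<open>
  Replacing \<open>e = (x, y)\<close> by \<open>(x, z)\<close> and \<open>(z, y)\<close>: the name \<open>e\<close> is reused for \<open>(x, z)\<close>,
  the fresh arc \<open>f\<close> is \<open>(z, y)\<close>.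
\<close>

definition subdivide_arc :: "network \<Rightarrow> nat \<Rightarrow> network" where
  "subdivide_arc N e = (let z = fresh (verts N); f = fresh (arcs N) in
     N\<lparr>verts := insert z (verts N),
       arcs := insert f (arcs N),
       tail := (tail N)(f := z),
       head := (head N)(e := z, f := head N e)\<rparr>)"

definition grow :: "network \<Rightarrow> network pmf" where
  "grow N = map_pmf
     (\<lambda>e. if out_degree N (tail N e) = 1 then add_parallel N e else subdivide_arc N e)
     (pmf_of_set (arcs N))"

text \<open>The argument is the size; size \<open>0\<close> does not occur in the model and gets a dummy value.\<close>

fun random_network :: "nat \<Rightarrow> network pmf" where
  "random_network 0 = return_pmf single_edge"
| "random_network (Suc 0) = return_pmf single_edge"
| "random_network (Suc (Suc n)) = bind_pmf (random_network (Suc n)) grow"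

text \<open>
  The random walk from \<open>v\<close> along arcs, stopped at the sink and in any case after \<open>k\<close> steps.
  Networks are acyclic, so a walk has at most as many steps as there are arcs, and with that
  bound the walk always ends at the sink; see \<open>random_path_awalk\<close> below.
\<close>

primrec random_walk :: "network \<Rightarrow> nat \<Rightarrow> nat \<Rightarrow> nat awalk pmf" where
  "random_walk N 0 v = return_pmf []"
| "random_walk N (Suc k) v =
    (if v = sink then return_pmf []
     else bind_pmf (pmf_of_set (out_arcs N v))
            (\<lambda>e. map_pmf ((#) e) (random_walk N k (head N e))))"

definition random_path :: "network \<Rightarrow> nat awalk pmf" where
  "random_path N = random_walk N (card (arcs N)) source"

text \<open>The law of \<open>L\<^sub>n\<close>.\<close>

definition path_length :: "nat \<Rightarrow> nat pmf" where
  "path_length n = bind_pmf (random_network n) (\<lambda>N. map_pmf length (random_path N))"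

definition \<phi> :: real where
  "\<phi> = (sqrt 5 - 1) / 2"

fun c :: "nat \<Rightarrow> real" where
  "c r = (if r = 0 then 1
          else if r = 1 then (3 + \<phi>) / 5
          else 1 / ((real r - 1) * \<phi> * ((real r + 1) * \<phi> + 1))
                 * (\<Sum>k = 1..r - 1. (real k * \<phi> + 1) * c k * c (r - k)))"

declare c.simps [simp del]

definition sp_network :: "network \<Rightarrow> bool" where
  "sp_network N \<longleftrightarrow> fin_digraph N \<and> source \<in> verts N \<and> sink \<in> verts N \<and> arcs N \<noteq> {} \<and>
     out_degree N sink = 0 \<and>
     (\<forall>v \<in> verts N - {sink}. out_degree N v = 1 \<or> out_degree N v = 2) \<and>
     (\<exists>rank :: nat \<Rightarrow> real. \<forall>e \<in> arcs N. rank (tail N e) < rank (head N e))"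

lemma fresh_notin: "finite A \<Longrightarrow> fresh A \<notin> A"
  unfolding fresh_def using Max_ge not_less_eq_eq by blast

lemma sp_network_single_edge: "sp_network single_edge"
proof -
  have "wf_digraph single_edge"
    by unfold_locales (auto simp: single_edge_def)
  then have "fin_digraph single_edge"
    by (intro fin_digraph.intro fin_digraph_axioms.intro) (auto simp: single_edge_def)
  moreover have "out_arcs single_edge source = {0}" "out_arcs single_edge sink = {}"
    by (auto simp: out_arcs_def single_edge_def source_def sink_def)
  moreover have "\<exists>rank :: nat \<Rightarrow> real. rank source < rank sink"
    by (rule exI[of _ real]) (simp add: source_def sink_def)
  ultimately show ?thesis
    by (auto simp: sp_network_def out_degree_def single_edge_def)
qed

lemma sp_network_add_parallel:
  assumes N: "sp_network N" and e: "e \<in> arcs N" and deg: "out_degree N (tail N e) = 1"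
  shows "sp_network (add_parallel N e)" "card (arcs (add_parallel N e)) = Suc (card (arcs N))"
proof -
  define f where "f = fresh (arcs N)"
  let ?M = "add_parallel N e"
  interpret fin_digraph N using N by (simp add: sp_network_def)
  have f: "f \<notin> arcs N" unfolding f_def by (rule fresh_notin) simp
  have sel: "verts ?M = verts N" "arcs ?M = insert f (arcs N)"
    "tail ?M = (tail N)(f := tail N e)" "head ?M = (head N)(f := head N e)"
    by (simp_all add: add_parallel_def Let_def f_def)
  have "wf_digraph ?M"
    using e by unfold_locales (auto simp: sel split: if_splits)
  then have "fin_digraph ?M"
    by (intro fin_digraph.intro fin_digraph_axioms.intro) (auto simp: sel)
  moreover have out: "out_arcs ?M v = (if v = tail N e then insert f (out_arcs N v) else out_arcs N v)" for v
    using f by (auto simp: out_arcs_def sel)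
  have "out_degree ?M v = (if v = tail N e then 2 else out_degree N v)" for v
    using f deg unfolding out_degree_def out by (auto simp: out_arcs_def)
  moreover have "tail N e \<noteq> sink" using N deg by (auto simp: sp_network_def)
  moreover obtain rank :: "nat \<Rightarrow> real" where "\<forall>e \<in> arcs N. rank (tail N e) < rank (head N e)"
    using N by (auto simp: sp_network_def)
  then have "\<forall>a \<in> arcs ?M. rank (tail ?M a) < rank (head ?M a)"
    using e f by (auto simp: sel)
  then have "\<exists>rank :: nat \<Rightarrow> real. \<forall>a \<in> arcs ?M. rank (tail ?M a) < rank (head ?M a)" by blast
  ultimately show "sp_network ?M"
    using N unfolding sp_network_def by (simp add: sel)
  show "card (arcs ?M) = Suc (card (arcs N))" using f by (simp add: sel)
qed

lemma sp_network_subdivide_arc: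
  assumes N: "sp_network N" and e: "e \<in> arcs N"
  shows "sp_network (subdivide_arc N e)" "card (arcs (subdivide_arc N e)) = Suc (card (arcs N))"
proof -
  define f where "f = fresh (arcs N)"
  define z where "z = fresh (verts N)"
  let ?M = "subdivide_arc N e"
  interpret fin_digraph N using N by (simp add: sp_network_def)
  have f: "f \<notin> arcs N" unfolding f_def by (rule fresh_notin) simp
  have z: "z \<notin> verts N" unfolding z_def by (rule fresh_notin) simp
  have sel: "verts ?M = insert z (verts N)" "arcs ?M = insert f (arcs N)"
    "tail ?M = (tail N)(f := z)" "head ?M = (head N)(e := z, f := head N e)"
    by (simp_all add: subdivide_arc_def Let_def f_def z_def)
  have "wf_digraph ?M"
    using e by unfold_locales (auto simp: sel split: if_splits)
  then have "fin_digraph ?M"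
    by (intro fin_digraph.intro fin_digraph_axioms.intro) (auto simp: sel)
  moreover have out: "out_arcs ?M v = (if v = z then {f} else out_arcs N v)" for v
    using f z by (auto simp: out_arcs_def sel)
  have "out_degree ?M v = (if v = z then 1 else out_degree N v)" for v
    unfolding out_degree_def out by auto
  moreover have "z \<noteq> sink" using N z by (auto simp: sp_network_def)
  moreover obtain rank :: "nat \<Rightarrow> real" where rank: "\<forall>e \<in> arcs N. rank (tail N e) < rank (head N e)"
    using N by (auto simp: sp_network_def)
  define rank' where "rank' = rank(z := (rank (tail N e) + rank (head N e)) / 2)"
  have "rank' (tail ?M a) < rank' (head ?M a)" if a: "a \<in> arcs ?M" for a
  proof -
    have ne: "tail N b \<noteq> z" "head N b \<noteq> z" if "b \<in> arcs N" for b
      using z tail_in_verts[OF that] head_in_verts[OF that] by auto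
    have re: "rank (tail N e) < rank (head N e)" using rank e by blast
    consider "a = f" | "a = e" "a \<noteq> f" | "a \<in> arcs N" "a \<noteq> e" "a \<noteq> f" using a by (auto simp: sel)
    then show ?thesis
      by cases (use ne re rank e in \<open>auto simp: sel rank'_def\<close>)
  qed
  then have "\<exists>rank :: nat \<Rightarrow> real. \<forall>a \<in> arcs ?M. rank (tail ?M a) < rank (head ?M a)" by blast
  ultimately show "sp_network ?M"
    using N unfolding sp_network_def by (auto simp: sel)
  show "card (arcs ?M) = Suc (card (arcs N))" using f by (simp add: sel)
qed

lemma sp_network_grow:
  assumes N: "sp_network N" and M: "M \<in> set_pmf (grow N)"
  shows "sp_network M \<and> card (arcs M) = Suc (card (arcs N))"
proof -
  have "finite (arcs N)" "arcs N \<noteq> {}"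
    using N by (auto simp: sp_network_def intro: fin_digraph.finite_arcs)
  then show ?thesis
    using M N sp_network_add_parallel sp_network_subdivide_arc
    by (auto simp: grow_def split: if_splits)
qed

lemma random_network_sp_network:
  assumes "n \<ge> 1" "N \<in> set_pmf (random_network n)"
  shows "sp_network N \<and> card (arcs N) = n"
  using assms
proof (induction n arbitrary: N rule: random_network.induct)
  case 2
  then show ?case using sp_network_single_edge by (simp add: single_edge_def)
next
  case (3 n)
  then obtain N' where "N' \<in> set_pmf (random_network (Suc n))" "N \<in> set_pmf (grow N')"
    by auto
  then show ?case using 3 sp_network_grow[of N' N] by auto
qed simp

lemma sp_network_walk_distinct:
  fixes rank :: "nat \<Rightarrow> real"
  assumes rank: "\<forall>e \<in> arcs N. rank (tail N e) < rank (head N e)"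
  shows "set p \<subseteq> arcs N \<Longrightarrow> pre_digraph.cas N u p w \<Longrightarrow>
    distinct p \<and> (\<forall>e \<in> set p. rank u \<le> rank (tail N e))"
proof (induction p arbitrary: u)
  case (Cons a p)
  then have "rank (tail N a) < rank (head N a)" "tail N a = u"
    "distinct p \<and> (\<forall>e \<in> set p. rank (head N a) \<le> rank (tail N e))"
    using rank by (auto simp: pre_digraph.cas.simps)
  then show ?case by fastforce
qed simp

lemma sp_network_out_arcs:
  assumes "sp_network N" "v \<in> verts N" "v \<noteq> sink"
  shows "out_arcs N v \<noteq> {}"
proof
  assume "out_arcs N v = {}"
  then have "out_degree N v = 0" by (simp add: out_degree_def)
  moreover have "v \<in> verts N - {sink}" using assms by blast
  then have "out_degree N v = 1 \<or> out_degree N v = 2"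
    using assms(1) unfolding sp_network_def by blast
  ultimately show False by simp
qed

lemma random_walk_awalk:
  assumes N: "sp_network N"
  shows "v \<in> verts N \<Longrightarrow> p \<in> set_pmf (random_walk N k v) \<Longrightarrow>
    \<exists>w. pre_digraph.awalk N v p w \<and> (w = sink \<or> length p = k)"
proof (induction k arbitrary: v p)
  case 0
  then show ?case by (auto simp: pre_digraph.awalk_def pre_digraph.cas.simps)
next
  case (Suc k)
  interpret fin_digraph N using N by (simp add: sp_network_def)
  show ?case
  proof (cases "v = sink")
    case True
    then show ?thesis using Suc.prems by (auto simp: pre_digraph.awalk_def pre_digraph.cas.simps)
  next
    case False
    then have "out_arcs N v \<noteq> {}" "finite (out_arcs N v)"
      using sp_network_out_arcs[OF N] Suc.prems by auto
    then have "set_pmf (random_walk N (Suc k) v) =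
        (\<Union>e\<in>out_arcs N v. (#) e ` set_pmf (random_walk N k (head N e)))"
      using False by simp
    then obtain e q where e: "e \<in> out_arcs N v" and q: "q \<in> set_pmf (random_walk N k (head N e))"
      and p: "p = e # q"
      using Suc.prems(2) by blast
    from e have e': "e \<in> arcs N" "tail N e = v" by auto
    obtain w where "pre_digraph.awalk N (head N e) q w" "w = sink \<or> length q = k"
      using Suc.IH[OF _ q] e' by auto
    then show ?thesis
      using p e' Suc.prems by (auto simp: pre_digraph.awalk_def pre_digraph.cas.simps)
  qed
qed

lemma random_path_awalk:
  assumes N: "sp_network N" and p: "p \<in> set_pmf (random_path N)"
  shows "pre_digraph.awalk N source p sink"
proof -
  interpret fin_digraph N using N by (simp add: sp_network_def)
  have "source \<in> verts N" using N by (simp add: sp_network_def)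
  from random_walk_awalk[OF N this] p
  obtain w where w: "awalk source p w" "w = sink \<or> length p = card (arcs N)"
    unfolding random_path_def by blast
  have "w = sink"
  proof (rule ccontr)
    assume "w \<noteq> sink"
    moreover have "w \<in> verts N" using w by (simp add: awalk_last_in_verts)
    ultimately have "out_arcs N w \<noteq> {}" using sp_network_out_arcs[OF N] by blast
    then obtain e where e: "e \<in> arcs N" "tail N e = w" by (meson ex_in_conv in_out_arcs_conv)
    have *: "awalk source (p @ [e]) (head N e)"
      using w e by (auto simp: awalk_def cas_append_iff)
    obtain rank :: "nat \<Rightarrow> real" where "\<forall>e \<in> arcs N. rank (tail N e) < rank (head N e)"
      using N by (auto simp: sp_network_def)
    from sp_network_walk_distinct[OF this] * have "distinct (p @ [e])" "set (p @ [e]) \<subseteq> arcs N"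
      unfolding awalk_def by blast+
    then have "length (p @ [e]) \<le> card (arcs N)"
      by (metis card_mono distinct_card finite_arcs)
    with w \<open>w \<noteq> sink\<close> show False by simp
  qed
  with w show ?thesis by simp
qed

end

theory Submission
  imports
    Defs
    "HOL-Computational_Algebra.Formal_Power_Series"
    "HOL-Real_Asymp.Real_Asymp"
begin

text \<open>
  Let \<open>x\<close> and \<open>y\<close> be the numbers of arcs on a random path whose tail has out-degree 1 and 2. When
  the network of size \<open>n\<close> grows, averaging over the random path shows that \<open>(x, y)\<close> is a Markov
  chain: it moves to \<open>(x - 1, y + 1)\<close> with probability \<open>x / n\<close>, to \<open>(x + 1, y)\<close> with probability
  \<open>y / n\<close>, and stays put otherwise. If \<open>h\<close> is an eigenfunction of the generator with eigenvalue \<open>\<mu>\<close>,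
  then \<open>E h(x, y)\<close> is a product of factors \<open>1 + \<mu> / k\<close>. The linear eigenfunctions have the
  eigenvalues \<open>\<phi>\<close> and \<open>- 1 - \<phi>\<close> and give the exact mean.

  With \<open>F = \<Sum> c\<^sub>r t\<^sup>r\<close> and \<open>H = F + \<phi> t F'\<close>, the recursion for \<open>c\<close> says \<open>\<phi> t H' = H F - H\<close>, which
  makes the coefficient of \<open>t\<^sup>r\<close> in \<open>F\<^sup>x H\<^sup>y\<close> an eigenfunction with eigenvalue \<open>r \<phi>\<close>. It is a
  polynomial in \<open>(x, y)\<close> whose leading part is \<open>P\<^sup>r / r!\<close> for the linear eigenfunction \<open>P\<close> of
  eigenvalue \<open>\<phi>\<close>, so the moments of \<open>P / n\<^sup>\<phi>\<close> converge. The path length \<open>x + y\<close> differs from \<open>P\<close>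
  by the decaying linear eigenfunction, which is \<open>O(\<surd>n)\<close> in mean square and hence negligible as
  \<open>\<phi> > 1/2\<close>. The limiting moments grow slowly enough to determine their distribution.
\<close>

section \<open>The method of moments\<close>

text \<open>Powers are unbounded, so weak convergence does not apply to them directly. Truncation
  gives bounded continuous test functions, and the convergent even moments control the truncation
  error uniformly in \<open>n\<close>.\<close>

lemma weak_conv_moments:
  fixes M :: "nat \<Rightarrow> real measure" and m :: "nat \<Rightarrow> real"
  assumes M: "\<And>n. real_distribution (M n)" and L: "real_distribution L" and weak: "weak_conv_m M L"
    and int: "\<And>n r. integrable (M n) (\<lambda>x. x ^ r)"
    and lim: "\<And>r. (\<lambda>n. \<integral>x. x ^ r \<partial>M n) \<longlonglongrightarrow> m r"
  shows "has_bochner_integral L (\<lambda>x. x ^ r) (m r)"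
proof -
  interpret M: real_distribution "M n" for n by (rule M)
  interpret L: real_distribution L by (rule L)
  have bdd_conv: "(\<lambda>n. \<integral>x. f x \<partial>M n) \<longlonglongrightarrow> (\<integral>x. f x \<partial>L)"
    if "\<And>x. isCont f x" "\<And>x. norm (f x) \<le> B" for f :: "real \<Rightarrow> real" and B
    using weak_conv_imp_integral_bdd_continuous_conv[OF M L weak that] .

  have even: "integrable L (\<lambda>x. x ^ (2 * s)) \<and> (\<integral>x. x ^ (2 * s) \<partial>L) \<le> m (2 * s)" for s
  proof -
    \<comment> \<open>\<open>h i\<close> is bounded and continuous, so its integral under
      \<open>L\<close> is a limit of integrals that lie below even moments. As \<open>i\<close>
      grows, monotone convergence gives integrability.\<close>
    define h where "h i x = (min (real i) \<bar>x\<bar>) ^ (2 * s)" for i and x :: real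
    have h_le: "h i x \<le> x ^ (2 * s)" for i x
    proof -
      have "h i x \<le> \<bar>x\<bar> ^ (2 * s)" unfolding h_def by (intro power_mono) auto
      then show ?thesis by (simp add: power_mult)
    qed
    have h_bd: "norm (h i x) \<le> real i ^ (2 * s)" for i x
      unfolding h_def by (auto intro!: power_mono)
    have h_cont: "isCont (h i) x" for i x
      unfolding h_def by (intro continuous_intros)
    have h_meas [measurable]: "h i \<in> borel_measurable borel" for i
      unfolding h_def by measurable
    have h_int: "integrable L (h i)" for i
      by (rule L.integrable_const_bound[where B = "real i ^ (2 * s)"]) (use h_bd in auto)
    have h_intM: "integrable (M n) (h i)" for i n
      by (rule M.integrable_const_bound[where B = "real i ^ (2 * s)"]) (use h_bd in auto)
    have h_mono: "h i x \<le> h j x" if "i \<le> j" for i j x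
      unfolding h_def using that by (intro power_mono) auto
    have h_m: "(\<integral>x. h i x \<partial>L) \<le> m (2 * s)" for i
      by (rule LIMSEQ_le[OF bdd_conv[of "h i", OF h_cont h_bd] lim])
         (use h_le h_intM int in \<open>auto intro!: integral_mono\<close>)
    have "incseq (\<lambda>i. \<integral>x. h i x \<partial>L)"
      by (auto intro!: incseq_SucI integral_mono h_int h_mono)
    then obtain l where l: "(\<lambda>i. \<integral>x. h i x \<partial>L) \<longlonglongrightarrow> l"
      using incseq_convergent h_m by metis
    have h_lim: "(\<lambda>i. h i x) \<longlonglongrightarrow> x ^ (2 * s)" for x
    proof (rule tendsto_eventually)
      have "\<forall>\<^sub>F i in sequentially. \<bar>x\<bar> \<le> real i"
        using eventually_ge_at_top[of "nat \<lceil>\<bar>x\<bar>\<rceil>"] by eventually_elim linarith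
      then show "\<forall>\<^sub>F i in sequentially. h i x = x ^ (2 * s)"
        by eventually_elim (simp add: h_def min_absorb2 power_mult)
    qed
    have "has_bochner_integral L (\<lambda>x. x ^ (2 * s)) l"
      by (rule has_bochner_integral_monotone_convergence[OF h_int _ _ l])
         (use h_mono h_lim in \<open>auto simp: incseq_def mono_def\<close>)
    moreover have "l \<le> m (2 * s)"
      by (rule LIMSEQ_le_const2[OF l]) (use h_m in auto)
    ultimately show ?thesis by (simp add: has_bochner_integral_iff)
  qed

  have pow_le: "\<bar>x ^ r\<bar> \<le> 1 + x ^ (2 * r)" for x :: real
  proof -
    have "0 \<le> (\<bar>x ^ r\<bar> - 1)\<^sup>2" by simp
    then have "2 * \<bar>x ^ r\<bar> \<le> 1 + x ^ (2 * r)"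
      by (simp add: power2_diff power_mult[symmetric] power_even_eq mult.commute)
    then show ?thesis by linarith
  qed
  have intL: "integrable L (\<lambda>x. x ^ r)"
    by (rule Bochner_Integration.integrable_bound[where f = "\<lambda>x. 1 + x ^ (2 * r)"])
       (use even[of r] pow_le in \<open>auto intro!: AE_I2 simp: order.trans[OF _ abs_ge_self]\<close>)
  have "(\<integral>x. x ^ r \<partial>L) = m r"
  proof (cases "r = 0")
    \<comment> \<open>For \<open>r = 0\<close> the error bound used in the other case does not
      shrink as \<open>K\<close> grows; total mass one settles this case.\<close>
    case True
    have "(\<lambda>n. \<integral>x. x ^ 0 \<partial>M n) = (\<lambda>_. 1)" using M.prob_space by auto
    then have "m 0 = 1"
      using lim[of 0] LIMSEQ_unique tendsto_const by metis
    then show ?thesis using True L.prob_space by simp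
  next
    case False
    have bound: "\<bar>(\<integral>x. x ^ r \<partial>L) - m r\<bar> \<le> 4 * m (2 * r) * (1 / K) ^ r" if "K > 0" for K
    proof -
      \<comment> \<open>\<open>g x\<close> differs from \<open>x ^ r\<close> only where
        \<open>\<bar>x\<bar> > K\<close>. There \<open>(\<bar>x\<bar> / K) ^ r \<ge> 1\<close>, so
        one more power \<open>\<bar>x\<bar> ^ r\<close> buys the small factor
        \<open>(1 / K) ^ r\<close>.\<close>
      define g where "g x = (max (- K) (min K x)) ^ r" for x :: real
      have g_cont: "isCont g x" for x unfolding g_def by (intro continuous_intros)
      have g_bd: "norm (g x) \<le> K ^ r" for x
        unfolding g_def norm_power using that by (intro power_mono) auto
      have [measurable]: "g \<in> borel_measurable borel" unfolding g_def by measurable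
      have diff: "\<bar>x ^ r - g x\<bar> \<le> 2 * (1 / K) ^ r * x ^ (2 * r)" for x
      proof (cases "\<bar>x\<bar> \<le> K")
        case True
        then have "max (- K) (min K x) = x" by auto
        then have "g x = x ^ r" by (simp add: g_def)
        then show ?thesis using that by simp
      next
        case False
        have "\<bar>g x\<bar> \<le> K ^ r" using g_bd[of x] by simp
        also have "\<dots> \<le> \<bar>x\<bar> ^ r" using False that by (intro power_mono) auto
        finally have "\<bar>x ^ r - g x\<bar> \<le> 2 * \<bar>x\<bar> ^ r"
          using power_abs[of x r] by linarith
        also have "\<bar>x\<bar> ^ r = K ^ r * (1 / K) ^ r * \<bar>x\<bar> ^ r"
          using that by (simp add: power_one_over)
        also have "\<dots> \<le> \<bar>x\<bar> ^ r * (1 / K) ^ r * \<bar>x\<bar> ^ r"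
          using False that by (intro mult_right_mono power_mono) auto
        also have "\<dots> = (1 / K) ^ r * \<bar>x\<bar> ^ (2 * r)"
          by (simp add: mult_2 power_add)
        also have "\<bar>x\<bar> ^ (2 * r) = x ^ (2 * r)" by (rule power_even_abs) simp
        finally show ?thesis by (simp add: mult.assoc)
      qed
      have gM: "integrable (M n) g" for n
        by (rule M.integrable_const_bound[where B = "K ^ r"]) (use g_bd in auto)
      have gL: "integrable L g"
        by (rule L.integrable_const_bound[where B = "K ^ r"]) (use g_bd in auto)
      have close: "\<bar>(\<integral>x. x ^ r \<partial>P) - (\<integral>x. g x \<partial>P)\<bar> \<le> 2 * (1 / K) ^ r * (\<integral>x. x ^ (2 * r) \<partial>P)"
        if "integrable P g" "integrable P (\<lambda>x. x ^ r)" "integrable P (\<lambda>x. x ^ (2 * r))"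
        for P :: "real measure"
      proof -
        have "\<bar>(\<integral>x. x ^ r \<partial>P) - (\<integral>x. g x \<partial>P)\<bar> = \<bar>\<integral>x. x ^ r - g x \<partial>P\<bar>"
          using that by simp
        also have "\<dots> \<le> (\<integral>x. \<bar>x ^ r - g x\<bar> \<partial>P)" by (rule integral_abs_bound)
        also have "\<dots> \<le> (\<integral>x. 2 * (1 / K) ^ r * x ^ (2 * r) \<partial>P)"
          using that diff by (intro integral_mono) auto
        finally show ?thesis by simp
      qed
      have "\<bar>m r - (\<integral>x. g x \<partial>L)\<bar> \<le> 2 * (1 / K) ^ r * m (2 * r)"
      proof (rule LIMSEQ_le)
        show "(\<lambda>n. \<bar>(\<integral>x. x ^ r \<partial>M n) - (\<integral>x. g x \<partial>M n)\<bar>) \<longlonglongrightarrow> \<bar>m r - (\<integral>x. g x \<partial>L)\<bar>"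
          by (intro tendsto_intros lim bdd_conv[OF g_cont g_bd])
        show "(\<lambda>n. 2 * (1 / K) ^ r * (\<integral>x. x ^ (2 * r) \<partial>M n)) \<longlonglongrightarrow> 2 * (1 / K) ^ r * m (2 * r)"
          by (intro tendsto_intros lim)
      qed (use close gM int in auto)
      moreover have "\<bar>(\<integral>x. x ^ r \<partial>L) - (\<integral>x. g x \<partial>L)\<bar> \<le> 2 * (1 / K) ^ r * m (2 * r)"
      proof -
        have "\<bar>(\<integral>x. x ^ r \<partial>L) - (\<integral>x. g x \<partial>L)\<bar> \<le> 2 * (1 / K) ^ r * (\<integral>x. x ^ (2 * r) \<partial>L)"
          using close gL intL even by auto
        also have "\<dots> \<le> 2 * (1 / K) ^ r * m (2 * r)"
          using even that by (intro mult_left_mono) auto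
        finally show ?thesis .
      qed
      ultimately show ?thesis by (simp add: algebra_simps)
    qed
    have "\<bar>(\<integral>x. x ^ r \<partial>L) - m r\<bar> \<le> 0"
    proof (rule LIMSEQ_le_const)
      have "(\<lambda>i. 4 * m (2 * r) * (1 / real (Suc i)) ^ r) \<longlonglongrightarrow> 4 * m (2 * r) * 0 ^ r"
        by (intro tendsto_mult tendsto_power tendsto_const LIMSEQ_Suc[OF lim_1_over_n])
      then show "(\<lambda>i. 4 * m (2 * r) * (1 / real (Suc i)) ^ r) \<longlonglongrightarrow> 0"
        by (simp only: power_0_left False if_False mult_zero_right)
      show "\<exists>N. \<forall>i\<ge>N. \<bar>(\<integral>x. x ^ r \<partial>L) - m r\<bar> \<le> 4 * m (2 * r) * (1 / real (Suc i)) ^ r"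
        by (intro exI allI impI bound of_nat_0_less_iff[THEN iffD2] zero_less_Suc)
    qed
    then show ?thesis by simp
  qed
  with intL show ?thesis by (simp add: has_bochner_integral_iff)
qed

text \<open>The Taylor polynomials of the characteristic function at 0 involve only moments, and by
  \<open>growth\<close> the remainders of even order vanish. Even orders are taken because the
  absolute moment in the remainder is then itself a moment. Both characteristic functions are limits
  of the same sequence, and Levy uniqueness applies.\<close>

lemma moments_determine_distribution:
  fixes m :: "nat \<Rightarrow> real"
  assumes L: "real_distribution L" "\<And>r. has_bochner_integral L (\<lambda>x. x ^ r) (m r)"
    and L': "real_distribution L'" "\<And>r. has_bochner_integral L' (\<lambda>x. x ^ r) (m r)"
    and growth: "\<And>t. (\<lambda>k. t ^ (2 * k) / fact (2 * k) * m (2 * k)) \<longlonglongrightarrow> 0"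
  shows "L = L'"
proof -
  have char_series: "(\<lambda>k. \<Sum>j\<le>2 * k. ((\<i> * of_real t) ^ j / fact j) * of_real (m j)) \<longlonglongrightarrow> char P t"
    if P: "real_distribution P" "\<And>r. has_bochner_integral P (\<lambda>x. x ^ r) (m r)" for P t
  proof -
    interpret P: real_distribution P by (rule P)
    have int: "integrable P (\<lambda>x. x ^ r)" "(\<integral>x. x ^ r \<partial>P) = m r" for r
      using P(2)[of r] unfolding has_bochner_integral_iff by blast+
    have bound: "norm ((\<Sum>j\<le>2 * k. ((\<i> * of_real t) ^ j / fact j) * of_real (m j)) - char P t)
        \<le> 2 * (t ^ (2 * k) / fact (2 * k) * m (2 * k))" for k
    proof -
      have abs: "\<bar>x\<bar> ^ (2 * k) = x ^ (2 * k)" for x :: real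
        by (rule power_even_abs) simp
      have "norm ((\<Sum>j\<le>2 * k. ((\<i> * of_real t) ^ j / fact j) * of_real (m j)) - char P t)
          \<le> 2 * t ^ (2 * k) / fact (2 * k) * m (2 * k)"
        using P.char_approx1[of "2 * k" t, OF int(1)] unfolding int(2) abs
        by (subst norm_minus_commute)
      then show ?thesis by (simp only: mult.assoc times_divide_eq_right)
    qed
    have lim: "(\<lambda>k. 2 * (t ^ (2 * k) / fact (2 * k) * m (2 * k))) \<longlonglongrightarrow> 0"
      by (rule tendsto_mult_right_zero[OF growth])
    show ?thesis
      by (rule LIM_zero_cancel, rule Lim_null_comparison[OF always_eventually lim]) (intro allI bound)
  qed
  have "char L t = char L' t" for t
    by (rule LIMSEQ_unique[OF char_series[OF L] char_series[OF L']])
  then show ?thesis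
    by (intro Levy_uniqueness L L') auto
qed

text \<open>Chebyshev's inequality bounds the mass outside \<open>{- a<..a}\<close> uniformly in
  \<open>n\<close>.\<close>

lemma tight_if_second_moments_bounded:
  assumes M: "\<And>n. real_distribution (M n)"
    and int: "\<And>n. integrable (M n) (\<lambda>x. x\<^sup>2)" and B: "\<And>n. (\<integral>x. x\<^sup>2 \<partial>M n) \<le> B"
  shows "tight M"
  unfolding tight_def
proof (intro conjI allI impI)
  fix \<epsilon> :: real assume \<epsilon>: "\<epsilon> > 0"
  interpret M: real_distribution "M n" for n by (rule M)
  \<comment> \<open>The added 1 makes the bound \<open>B / a\<^sup>2\<close> strictly smaller than
    \<open>\<epsilon>\<close>, even when \<open>B\<close> is zero.\<close>
  define a where "a = sqrt ((\<bar>B\<bar> + 1) / \<epsilon>)"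
  have "(\<bar>B\<bar> + 1) / \<epsilon> > 0" using \<epsilon> by (intro divide_pos_pos) auto
  then have a: "a > 0" "a\<^sup>2 = (\<bar>B\<bar> + 1) / \<epsilon>" by (simp_all add: a_def)
  have "measure (M n) {- a<..a} > 1 - \<epsilon>" for n
  proof -
    have "M.prob n {x \<in> space (M n). \<bar>x\<bar> \<ge> a} \<le> (\<integral>x. x\<^sup>2 \<partial>M n) / a\<^sup>2"
      by (rule M.second_moment_method[OF _ int \<open>a > 0\<close>]) simp
    also have "\<dots> \<le> B / a\<^sup>2" using B a(1) by (intro divide_right_mono) auto
    also have "\<dots> < (\<bar>B\<bar> + 1) / a\<^sup>2" using a(1) by (intro divide_strict_right_mono) auto
    also have "\<dots> = \<epsilon>" unfolding a(2) using \<epsilon> by simp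
    finally have "M.prob n {x \<in> space (M n). \<bar>x\<bar> \<ge> a} < \<epsilon>" .
    moreover have "M.prob n (space (M n) - {- a<..a}) \<le> M.prob n {x \<in> space (M n). \<bar>x\<bar> \<ge> a}"
      by (intro M.finite_measure_mono) auto
    moreover have "M.prob n (space (M n) - {- a<..a}) = 1 - M.prob n {- a<..a}"
      by (rule M.prob_compl) simp
    ultimately show ?thesis by simp
  qed
  then show "\<exists>a b. a < b \<and> (\<forall>n. 1 - \<epsilon> < measure (M n) {a<..b})"
    using a by (intro exI[of _ "- a"] exI[of _ a]) auto
qed (rule M)

text \<open>Convergent second moments are bounded, which gives tightness and a subsequential limit
  \<open>L\<close>. Every subsequential limit has the moments \<open>m\<close> and therefore equals
  \<open>L\<close>, so the whole sequence converges.\<close>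

theorem method_of_moments:
  fixes M :: "nat \<Rightarrow> real measure" and m :: "nat \<Rightarrow> real"
  assumes M: "\<And>n. real_distribution (M n)"
    and int: "\<And>n r. integrable (M n) (\<lambda>x. x ^ r)"
    and lim: "\<And>r. (\<lambda>n. \<integral>x. x ^ r \<partial>M n) \<longlonglongrightarrow> m r"
    and growth: "\<And>t. (\<lambda>k. t ^ (2 * k) / fact (2 * k) * m (2 * k)) \<longlonglongrightarrow> 0"
  obtains L where "real_distribution L" "weak_conv_m M L"
    "\<And>r. has_bochner_integral L (\<lambda>x. x ^ r) (m r)"
proof -
  have sub: "has_bochner_integral P (\<lambda>x. x ^ r) (m r)"
    if "strict_mono s" "real_distribution P" "weak_conv_m (M \<circ> s) P" for s P r
    using that M int LIMSEQ_subseq_LIMSEQ[OF lim \<open>strict_mono s\<close>]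
    by (intro weak_conv_moments[of "M \<circ> s"]) (auto simp: comp_def)
  obtain B where "\<forall>n. norm (\<integral>x. x ^ 2 \<partial>M n) \<le> B"
    using convergent_imp_Bseq[OF convergentI[OF lim[of 2]]] by (rule BseqE)
  then have tight: "tight M"
    using M int by (intro tight_if_second_moments_bounded[where B = B]) (auto simp: abs_le_iff)
  obtain r L where r: "strict_mono r" and L: "real_distribution L" "weak_conv_m (M \<circ> r) L"
    using tight_imp_convergent_subsubsequence[OF tight strict_mono_id] by auto
  have "weak_conv_m M L"
  proof (rule tight_subseq_weak_converge[OF M L(1) tight])
    fix s P assume s: "strict_mono s" "real_distribution P" "weak_conv_m (M \<circ> s) P"
    then have "P = L"
      using sub[OF s] sub[OF r L] L(1) growth by (intro moments_determine_distribution[of P m L]) auto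
    with s show "weak_conv_m (M \<circ> s) L" by simp
  qed
  with L sub[OF r L] that show thesis by blast
qed

section \<open>The Markov chain along a random path\<close>

lemma set_pmf_out_arcs:
  assumes "sp_network N" "v \<in> verts N" "v \<noteq> sink"
  shows "set_pmf (pmf_of_set (out_arcs N v)) = out_arcs N v"
proof -
  interpret fin_digraph N using assms by (simp add: sp_network_def)
  have "finite (out_arcs N v)" by (rule finite_subset[OF _ finite_arcs]) auto
  then show ?thesis by (intro set_pmf_of_set sp_network_out_arcs assms)
qed

lemma random_walk_sink [simp]: "random_walk N k sink = return_pmf []"
  by (cases k) auto

lemma random_walk_step:
  "v \<noteq> sink \<Longrightarrow> random_walk N (Suc k) v =
    bind_pmf (pmf_of_set (out_arcs N v)) (\<lambda>e. map_pmf ((#) e) (random_walk N k (head N e)))"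
  by simp

text \<open>The step bound \<open>k\<close> cuts no walk from \<open>v\<close> short. This form
  passes to the heads of out-arcs with \<open>k\<close> lowered by one, which suits induction on
  \<open>k\<close>.\<close>

definition walks_to_sink :: "network \<Rightarrow> nat \<Rightarrow> nat \<Rightarrow> bool" where
  "walks_to_sink N k v \<longleftrightarrow> (\<forall>p \<in> set_pmf (random_walk N k v). pre_digraph.awalk N v p sink)"

lemma walks_to_sink_0: "walks_to_sink N 0 v \<Longrightarrow> v = sink"
  by (auto simp: walks_to_sink_def pre_digraph.awalk_def pre_digraph.cas.simps)

lemma walks_to_sink_head:
  assumes N: "sp_network N" "v \<in> verts N" "v \<noteq> sink"
    and walks: "walks_to_sink N (Suc k) v" and e: "e \<in> out_arcs N v"
  shows "walks_to_sink N k (head N e)"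
  unfolding walks_to_sink_def
proof
  interpret fin_digraph N using N by (simp add: sp_network_def)
  fix p assume "p \<in> set_pmf (random_walk N k (head N e))"
  then have "e # p \<in> set_pmf (random_walk N (Suc k) v)"
    using e unfolding random_walk_step[OF N(3)] set_bind_pmf set_pmf_out_arcs[OF N] by auto
  then have "awalk v (e # p) sink" using walks by (auto simp: walks_to_sink_def)
  then show "awalk (head N e) p sink" by (simp add: awalk_Cons_iff)
qed

text \<open>A walk stops at the sink, so raising a sufficient bound changes nothing. This bridges
  the bounds before and after growth, since \<open>random_path\<close> uses the number of
  arcs.\<close>

lemma random_walk_stable:
  assumes N: "sp_network N"
  shows "v \<in> verts N \<Longrightarrow> walks_to_sink N k v \<Longrightarrow> k \<le> m \<Longrightarrow> random_walk N m v = random_walk N k v"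
proof (induction k arbitrary: v m)
  case 0
  then have "v = sink" using walks_to_sink_0 by blast
  then show ?case by simp
next
  case (Suc k)
  interpret fin_digraph N using N by (simp add: sp_network_def)
  obtain m' where m: "m = Suc m'" "k \<le> m'" using Suc.prems(3) by (cases m) auto
  show ?case
  proof (cases "v = sink")
    case False
    show ?thesis
      unfolding m random_walk_step[OF False]
    proof (rule bind_pmf_cong[OF refl], unfold set_pmf_out_arcs[OF N Suc.prems(1) False])
      fix e assume e: "e \<in> out_arcs N v"
      have "random_walk N m' (head N e) = random_walk N k (head N e)"
        using e m walks_to_sink_head[OF N Suc.prems(1) False Suc.prems(2) e]
        by (intro Suc.IH) auto
      then show "map_pmf ((#) e) (random_walk N m' (head N e)) =
          map_pmf ((#) e) (random_walk N k (head N e))" by simp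
    qed
  qed simp
qed

lemma walks_to_sink_source: "sp_network N \<Longrightarrow> walks_to_sink N (card (arcs N)) source"
  using random_path_awalk by (auto simp: walks_to_sink_def random_path_def)

lemma random_walk_source:
  "sp_network N \<Longrightarrow> card (arcs N) \<le> k \<Longrightarrow> random_walk N k source = random_path N"
  unfolding random_path_def
  by (intro random_walk_stable walks_to_sink_source) (auto simp: sp_network_def)

section \<open>Random paths after growth at one fixed arc\<close>

locale sp_arc = fin_digraph N for N :: network +
  fixes e :: nat
  assumes N: "sp_network N" and e: "e \<in> arcs N"
begin

abbreviation "f \<equiv> fresh (arcs N)"
abbreviation "z \<equiv> fresh (verts N)"

lemma f_notin: "f \<notin> arcs N" and z_notin: "z \<notin> verts N"
  by (simp_all add: fresh_notin)

lemma z_neq [simp]: "tail N a \<noteq> z" if "a \<in> arcs N"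
  using z_notin tail_in_verts[OF that] by auto

lemma parallel_sel:
  "verts (add_parallel N e) = verts N" "arcs (add_parallel N e) = insert f (arcs N)"
  "tail (add_parallel N e) = (tail N)(f := tail N e)"
  "head (add_parallel N e) = (head N)(f := head N e)"
  by (simp_all add: add_parallel_def Let_def)

lemma subdivide_sel:
  "verts (subdivide_arc N e) = insert z (verts N)" "arcs (subdivide_arc N e) = insert f (arcs N)"
  "tail (subdivide_arc N e) = (tail N)(f := z)"
  "head (subdivide_arc N e) = (head N)(e := z, f := head N e)"
  by (simp_all add: subdivide_arc_def Let_def)

lemma parallel_out_arcs:
  "out_arcs (add_parallel N e) v = (if v = tail N e then insert f (out_arcs N v) else out_arcs N v)"
  using f_notin by (auto simp: out_arcs_def parallel_sel)

lemma subdivide_out_arcs: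
  "out_arcs (subdivide_arc N e) v = (if v = z then {f} else out_arcs N v)"
  using f_notin z_notin by (auto simp: out_arcs_def subdivide_sel)

lemma out_arcs_tail_e: "out_degree N (tail N e) = 1 \<Longrightarrow> out_arcs N (tail N e) = {e}"
  using e unfolding out_degree_def by (metis card_1_singletonE in_out_arcs_conv singletonD)

text \<open>Identifies a parallel copy \<open>f\<close> with \<open>e\<close>. Paths are projected
  from the new network to the old one because the choice between \<open>e\<close> and
  \<open>f\<close> is not determined by the old path; for a subdivision, \<open>split\<close> goes
  the other way.\<close>

definition merge :: "nat \<Rightarrow> nat" where "merge a = (if a = f then e else a)"

definition split :: "nat list \<Rightarrow> nat list" where
  "split p = concat (map (\<lambda>a. if a = e then [e, f] else [a]) p)"

text \<open>At the tail of \<open>e\<close> the walk was forced to take \<open>e\<close>; it now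
  chooses between \<open>e\<close> and \<open>f\<close>, which \<open>merge\<close> identifies. All
  other choices are as before, and merging preserves length, so one bound \<open>k\<close> serves
  both sides.\<close>

lemma random_walk_parallel:
  assumes deg: "out_degree N (tail N e) = 1"
  shows "v \<in> verts N \<Longrightarrow>
    map_pmf (map merge) (random_walk (add_parallel N e) k v) = random_walk N k v"
proof (induction k arbitrary: v)
  case (Suc k)
  let ?M = "add_parallel N e"
  have M: "sp_network ?M" by (rule sp_network_add_parallel[OF N e deg])
  show ?case
  proof (cases "v = sink")
    case False
    have vM: "v \<in> verts ?M" using Suc.prems by (simp add: parallel_sel)
    have out: "map_pmf merge (pmf_of_set (out_arcs ?M v)) = pmf_of_set (out_arcs N v)"
    proof (cases "v = tail N e")
      case True
      then have "out_arcs ?M v = {e, f}" by (simp add: parallel_out_arcs out_arcs_tail_e[OF deg] insert_commute)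
      then have "map_pmf merge (pmf_of_set (out_arcs ?M v)) = map_pmf (\<lambda>_. e) (pmf_of_set (out_arcs ?M v))"
        by (intro map_pmf_cong refl) (auto simp: merge_def)
      also have "\<dots> = return_pmf e" by simp
      finally show ?thesis using True by (simp add: out_arcs_tail_e[OF deg] pmf_of_set_singleton)
    next
      case neq: False
      have "map_pmf merge (pmf_of_set (out_arcs ?M v)) = map_pmf id (pmf_of_set (out_arcs ?M v))"
      proof (intro map_pmf_cong refl)
        fix a assume "a \<in> set_pmf (pmf_of_set (out_arcs ?M v))"
        then have "a \<in> out_arcs N v"
          unfolding set_pmf_out_arcs[OF M vM False] using neq by (simp add: parallel_out_arcs)
        then show "merge a = id a" using f_notin by (auto simp: merge_def)
      qed
      then show ?thesis using neq by (simp add: parallel_out_arcs)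
    qed
    have "map_pmf (map merge) (random_walk ?M (Suc k) v) =
        bind_pmf (pmf_of_set (out_arcs ?M v))
          (\<lambda>a. map_pmf ((#) (merge a)) (map_pmf (map merge) (random_walk ?M k (head ?M a))))"
      unfolding random_walk_step[OF False] by (simp add: map_bind_pmf map_pmf_comp)
    also have "\<dots> = bind_pmf (pmf_of_set (out_arcs ?M v))
          (\<lambda>a. map_pmf ((#) (merge a)) (random_walk N k (head N (merge a))))"
    proof (rule bind_pmf_cong[OF refl], unfold set_pmf_out_arcs[OF M vM False])
      fix a assume "a \<in> out_arcs ?M v"
      then have a: "a = f \<or> a \<in> arcs N" by (auto simp: parallel_out_arcs split: if_splits)
      then have "head ?M a = head N (merge a)" by (auto simp: parallel_sel merge_def)
      moreover have "head N (merge a) \<in> verts N" using a e by (auto simp: merge_def)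
      ultimately show "map_pmf ((#) (merge a)) (map_pmf (map merge) (random_walk ?M k (head ?M a))) =
          map_pmf ((#) (merge a)) (random_walk N k (head N (merge a)))"
        using Suc.IH by simp
    qed
    also have "\<dots> = bind_pmf (map_pmf merge (pmf_of_set (out_arcs ?M v)))
          (\<lambda>a. map_pmf ((#) a) (random_walk N k (head N a)))"
      by (simp add: bind_map_pmf)
    finally show ?thesis unfolding out random_walk_step[OF False] .
  qed simp
qed simp

lemma random_path_parallel:
  assumes deg: "out_degree N (tail N e) = 1"
  shows "map_pmf (map merge) (random_path (add_parallel N e)) = random_path N"
proof -
  have "source \<in> verts N" using N by (simp add: sp_network_def)
  then have "map_pmf (map merge) (random_path (add_parallel N e)) =
      random_walk N (card (arcs (add_parallel N e))) source"
    unfolding random_path_def by (rule random_walk_parallel[OF deg])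
  also have "\<dots> = random_path N"
    using sp_network_add_parallel(2)[OF N e deg] by (intro random_walk_source N) simp
  finally show ?thesis .
qed

text \<open>
  The step bound doubles because the subdivision may lengthen a walk; stating it with a slack \<open>m\<close>
  keeps the induction on \<open>k\<close> free of any acyclicity argument.
\<close>

lemma random_walk_subdivide:
  "v \<in> verts N \<Longrightarrow> walks_to_sink N k v \<Longrightarrow> 2 * k \<le> m \<Longrightarrow>
    random_walk (subdivide_arc N e) m v = map_pmf split (random_walk N k v)"
proof (induction k arbitrary: v m)
  case 0
  then have "v = sink" using walks_to_sink_0 by blast
  then show ?case by (simp add: split_def)
next
  case (Suc k)
  let ?M = "subdivide_arc N e"
  obtain m' where m: "m = Suc (Suc m')" "2 * k \<le> m'" using Suc.prems(3) by (cases m; cases "m - 1") auto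
  show ?case
  proof (cases "v = sink")
    case False
    have out: "out_arcs ?M v = out_arcs N v" using Suc.prems(1) z_notin by (auto simp: subdivide_out_arcs)
    have "z \<noteq> sink" using N z_notin by (auto simp: sp_network_def)
    have "random_walk ?M m v = bind_pmf (pmf_of_set (out_arcs N v))
        (\<lambda>a. map_pmf ((#) a) (random_walk ?M (Suc m') (head ?M a)))"
      unfolding m random_walk_step[OF False] out ..
    also have "\<dots> = bind_pmf (pmf_of_set (out_arcs N v))
        (\<lambda>a. map_pmf split (map_pmf ((#) a) (random_walk N k (head N a))))"
    proof (rule bind_pmf_cong[OF refl], unfold set_pmf_out_arcs[OF N Suc.prems(1) False])
      fix a assume a: "a \<in> out_arcs N v"
      have IH: "random_walk ?M l (head N a) = map_pmf split (random_walk N k (head N a))"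
        if "2 * k \<le> l" for l
        using a that walks_to_sink_head[OF N Suc.prems(1) False Suc.prems(2) a]
        by (intro Suc.IH) auto
      have af: "a \<noteq> f" using a f_notin by auto
      show "map_pmf ((#) a) (random_walk ?M (Suc m') (head ?M a)) =
          map_pmf split (map_pmf ((#) a) (random_walk N k (head N a)))"
      proof (cases "a = e")
        case True
        then have "head ?M a = z" "head ?M f = head N a" using af by (auto simp: subdivide_sel)
        then have "random_walk ?M (Suc m') (head ?M a) = map_pmf ((#) f) (random_walk ?M m' (head N a))"
          using \<open>z \<noteq> sink\<close> by (simp add: subdivide_out_arcs pmf_of_set_singleton bind_return_pmf)
        then show ?thesis using IH[of m'] m True by (simp add: map_pmf_comp split_def)
      next
        case neq: False
        then have "head ?M a = head N a" using af by (auto simp: subdivide_sel)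
        then show ?thesis using IH[of "Suc m'"] m neq by (simp add: map_pmf_comp split_def del: random_walk.simps)
      qed
    qed
    also have "\<dots> = map_pmf split (random_walk N (Suc k) v)"
      unfolding random_walk_step[OF False] by (simp add: map_bind_pmf)
    finally show ?thesis .
  qed (simp add: split_def)
qed

lemma random_path_subdivide: "random_path (subdivide_arc N e) = map_pmf split (random_path N)"
proof -
  have src: "source \<in> verts N" using N by (simp add: sp_network_def)
  \<comment> \<open>The new network has \<open>card (arcs N) + 1\<close> arcs, at most
    \<open>2 * card (arcs N)\<close> because \<open>e\<close> exists. The doubled bound is the one
    that \<open>random_walk_subdivide\<close> handles.\<close>
  have "random_path (subdivide_arc N e) =
      random_walk (subdivide_arc N e) (2 * card (arcs N)) source"
    using sp_network_subdivide_arc[OF N e] e card_gt_0_iff[of "arcs N"]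
    by (intro random_walk_source[symmetric]) auto
  also have "\<dots> = map_pmf split (random_walk N (card (arcs N)) source)"
    by (intro random_walk_subdivide walks_to_sink_source src N) simp
  finally show ?thesis by (simp add: random_path_def)
qed

end

text \<open>The state of the Markov chain. In an \<open>sp_network\<close> the tail of an arc has
  out-degree 1 or 2; testing for \<open>\<noteq> 1\<close> lets the counts sum to the length without
  that fact.\<close>

definition arc_counts :: "network \<Rightarrow> nat list \<Rightarrow> nat \<times> nat" where
  "arc_counts N p = (length (filter (\<lambda>a. out_degree N (tail N a) = 1) p),
     length (filter (\<lambda>a. out_degree N (tail N a) \<noteq> 1) p))"

context sp_arc
begin

text \<open>Only \<open>e\<close> left its tail before, so exactly the arcs merging to
  \<open>e\<close> change class, from out-degree 1 to 2. The first equation is additive to avoid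
  truncated subtraction.\<close>

lemma arc_counts_parallel:
  assumes deg: "out_degree N (tail N e) = 1"
  shows "set p \<subseteq> insert f (arcs N) \<Longrightarrow>
    fst (arc_counts (add_parallel N e) p) + count_list (map merge p) e = fst (arc_counts N (map merge p)) \<and>
    snd (arc_counts (add_parallel N e) p) = snd (arc_counts N (map merge p)) + count_list (map merge p) e"
proof (induction p)
  case (Cons a p)
  let ?M = "add_parallel N e"
  have "out_degree ?M (tail N e) = 2"
    using f_notin e by (auto simp: out_degree_def parallel_out_arcs out_arcs_tail_e[OF deg] card_insert_if)
  then have "out_degree ?M (tail ?M a) = (if merge a = e then 2 else out_degree N (tail N (merge a)))"
  proof (cases "merge a = e")
    case False
    then have "a \<in> arcs N" "a \<noteq> f" "a \<noteq> e" using Cons.prems by (auto simp: merge_def)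
    then have "a \<notin> out_arcs N (tail N e)" using out_arcs_tail_e[OF deg] by auto
    then have "tail N a \<noteq> tail N e" using \<open>a \<in> arcs N\<close> by auto
    then show ?thesis using False \<open>a \<noteq> f\<close>
      by (simp add: out_degree_def parallel_out_arcs parallel_sel merge_def)
  qed (auto simp: merge_def parallel_sel split: if_splits)
  then show ?case using Cons deg by (auto simp: arc_counts_def)
qed (simp add: arc_counts_def)

text \<open>The new node \<open>z\<close> has out-degree 1 and old nodes keep theirs, so each
  passage through \<open>e\<close> keeps its class and adds \<open>f\<close> to the first
  count.\<close>

lemma arc_counts_split:
  assumes deg: "out_degree N (tail N e) \<noteq> 1"
  shows "set p \<subseteq> arcs N \<Longrightarrow> arc_counts (subdivide_arc N e) (split p) =
    (fst (arc_counts N p) + count_list p e, snd (arc_counts N p))"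
proof (induction p)
  case (Cons a p)
  let ?M = "subdivide_arc N e"
  have "out_degree ?M (tail ?M f) = 1"
    by (simp add: out_degree_def subdivide_out_arcs subdivide_sel)
  moreover have "out_degree ?M (tail ?M b) = out_degree N (tail N b)" if "b \<in> arcs N" for b
    using that f_notin by (auto simp: out_degree_def subdivide_out_arcs subdivide_sel)
  ultimately show ?case using Cons deg e by (auto simp: arc_counts_def split_def)
qed (simp add: arc_counts_def split_def)

end

section \<open>One growth step averaged over the arcs\<close>

definition grow_at :: "network \<Rightarrow> nat \<Rightarrow> network" where
  "grow_at N e = (if out_degree N (tail N e) = 1 then add_parallel N e else subdivide_arc N e)"

text \<open>Here \<open>k\<close> is 0 or 1 on actual paths, which repeat no arc;
  \<open>count_list\<close> postpones that fact to the averaging over \<open>e\<close>.\<close>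

definition jump :: "network \<Rightarrow> nat \<Rightarrow> nat list \<Rightarrow> nat \<times> nat" where
  "jump N e p = (let (x, y) = arc_counts N p; k = count_list p e in
     if out_degree N (tail N e) = 1 then (x - k, y + k) else (x + k, y))"

lemma random_path_arcs:
  assumes N: "sp_network N" and p: "p \<in> set_pmf (random_path N)"
  shows "set p \<subseteq> arcs N" "distinct p" "p \<noteq> []"
proof -
  interpret fin_digraph N using N by (simp add: sp_network_def)
  have walk: "awalk source p sink" by (rule random_path_awalk[OF N p])
  then show "set p \<subseteq> arcs N" by (simp add: awalk_def)
  obtain rank :: "nat \<Rightarrow> real" where "\<forall>e \<in> arcs N. rank (tail N e) < rank (head N e)"
    using N by (auto simp: sp_network_def)
  from sp_network_walk_distinct[OF this] walk show "distinct p" unfolding awalk_def by blast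
  show "p \<noteq> []" using walk by (auto simp: awalk_Nil_iff source_def sink_def)
qed

text \<open>For a parallel arc, the new counts depend on the new path only through its merged image,
  which is distributed as the old path. For a subdivision, the new path is a function of the old
  one.\<close>

lemma map_pmf_arc_counts_grow_at:
  assumes N: "sp_network N" and e: "e \<in> arcs N"
  shows "map_pmf (arc_counts (grow_at N e)) (random_path (grow_at N e)) =
    map_pmf (jump N e) (random_path N)"
proof -
  interpret sp_arc N e
    using N e by (simp add: sp_arc_def sp_arc_axioms_def sp_network_def)
  show ?thesis
  proof (cases "out_degree N (tail N e) = 1")
    case deg: True
    let ?M = "add_parallel N e"
    have "map_pmf (jump N e) (random_path N) = map_pmf (\<lambda>p. jump N e (map merge p)) (random_path ?M)"
      by (simp add: map_pmf_comp flip: random_path_parallel[OF deg])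
    also have "\<dots> = map_pmf (arc_counts ?M) (random_path ?M)"
    proof (rule map_pmf_cong[OF refl])
      fix p assume p: "p \<in> set_pmf (random_path ?M)"
      have "set p \<subseteq> insert f (arcs N)"
        using random_path_arcs(1)[OF sp_network_add_parallel(1)[OF N e deg] p] by (simp add: parallel_sel)
      from arc_counts_parallel[OF deg this] show "jump N e (map merge p) = arc_counts ?M p"
        using deg by (auto simp: jump_def Let_def case_prod_beta prod_eq_iff)
    qed
    finally show ?thesis using deg by (simp add: grow_at_def)
  next
    case deg: False
    have "map_pmf (arc_counts (grow_at N e)) (random_path (grow_at N e)) =
        map_pmf (\<lambda>p. arc_counts (subdivide_arc N e) (split p)) (random_path N)"
      using deg by (simp add: grow_at_def random_path_subdivide map_pmf_comp)
    also have "\<dots> = map_pmf (jump N e) (random_path N)"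
      using arc_counts_split[OF deg] random_path_arcs(1)[OF N] deg
      by (intro map_pmf_cong refl) (simp add: jump_def case_prod_beta)
    finally show ?thesis .
  qed
qed

text \<open>The expected one-step change of \<open>h\<close>, multiplied by the size. At
  \<open>x = 0\<close> the truncated \<open>x - 1\<close> is multiplied by zero.\<close>

definition generator :: "(nat \<times> nat \<Rightarrow> real) \<Rightarrow> nat \<times> nat \<Rightarrow> real" where
  "generator h = (\<lambda>(x, y). real x * (h (x - 1, y + 1) - h (x, y)) + real y * (h (x + 1, y) - h (x, y)))"

text \<open>Arcs off the path leave the counts unchanged. As the path repeats no arc,
  \<open>x\<close> of its arcs trigger the first kind of move and \<open>y\<close> the
  second.\<close>

lemma sum_jump:
  assumes N: "sp_network N" and p: "set p \<subseteq> arcs N" "distinct p"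
  shows "(\<Sum>e\<in>arcs N. h (jump N e p)) =
    real (card (arcs N)) * h (arc_counts N p) + generator h (arc_counts N p)"
proof -
  interpret fin_digraph N using N by (simp add: sp_network_def)
  obtain x y where xy: "arc_counts N p = (x, y)" by force
  let ?P = "\<lambda>a. out_degree N (tail N a) = 1"
  have card: "x = card {a \<in> set p. ?P a}" "y = card {a \<in> set p. \<not> ?P a}"
    using xy p by (auto simp: arc_counts_def simp flip: distinct_card)
  have count1: "count_list p a = 1" if "a \<in> set p" for a
    using p(2) that by (induction p) auto
  have "(\<Sum>e\<in>arcs N. h (jump N e p) - h (x, y)) = (\<Sum>e\<in>set p. h (jump N e p) - h (x, y))"
    using p by (intro sum.mono_neutral_right) (auto simp: jump_def xy)
  also have "\<dots> = (\<Sum>e\<in>set p. if ?P e then h (x - 1, y + 1) - h (x, y) else h (x + 1, y) - h (x, y))"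
    using count1 by (intro sum.cong refl) (auto simp: jump_def xy)
  also have "\<dots> = real x * (h (x - 1, y + 1) - h (x, y)) + real y * (h (x + 1, y) - h (x, y))"
    by (simp add: sum.If_cases card Int_def conj_commute)
  finally show ?thesis
    by (simp add: sum_subtractf generator_def xy)
qed


section \<open>The law of the arc counts\<close>

lemma expectation_bind_pmf_finite:
  fixes h :: "'b \<Rightarrow> real"
  assumes "finite (set_pmf p)" "\<And>x. x \<in> set_pmf p \<Longrightarrow> finite (set_pmf (q x))"
    and "\<And>x. x \<in> set_pmf p \<Longrightarrow> measure_pmf.expectation (q x) h = g x"
  shows "measure_pmf.expectation (bind_pmf p q) h = measure_pmf.expectation p g"
proof -
  have "measure_pmf.expectation (bind_pmf p q) h =
      (\<Sum>x\<in>set_pmf p. pmf p x *\<^sub>R measure_pmf.expectation (q x) h)"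
    using assms by (intro pmf_expectation_bind) auto
  also have "\<dots> = (\<Sum>x\<in>set_pmf p. pmf p x *\<^sub>R g x)"
    using assms by simp
  also have "\<dots> = measure_pmf.expectation p g"
    using assms by (intro integral_measure_pmf[symmetric]) auto
  finally show ?thesis .
qed

lemma grow_eq_map_grow_at: "grow N = map_pmf (grow_at N) (pmf_of_set (arcs N))"
  unfolding grow_def grow_at_def ..

lemma sp_network_finite_arcs: "sp_network N \<Longrightarrow> finite (arcs N) \<and> arcs N \<noteq> {}"
  by (auto simp: sp_network_def intro: fin_digraph.finite_arcs)

lemma finite_random_network: "n \<ge> 1 \<Longrightarrow> finite (set_pmf (random_network n))"
proof (induction n rule: random_network.induct)
  case (3 n)
  have "finite (set_pmf (grow N))" if "N \<in> set_pmf (random_network (Suc n))" for N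
    using random_network_sp_network[OF _ that] sp_network_finite_arcs[of N]
    by (simp add: grow_eq_map_grow_at)
  with 3 show ?case by simp
qed auto

lemma finite_random_path:
  assumes N: "sp_network N"
  shows "finite (set_pmf (random_path N))"
proof (rule finite_subset)
  show "set_pmf (random_path N) \<subseteq> {p. set p \<subseteq> arcs N \<and> distinct p}"
    using random_path_arcs[OF N] by auto
  show "finite {p. set p \<subseteq> arcs N \<and> distinct p}"
    using sp_network_finite_arcs[OF N] by (intro finite_subset_distinct) auto
qed

definition count_law :: "nat \<Rightarrow> (nat \<times> nat) pmf" where
  "count_law n = bind_pmf (random_network n) (\<lambda>N. map_pmf (arc_counts N) (random_path N))"

lemma path_length_eq: "path_length n = map_pmf (\<lambda>(x, y). x + y) (count_law n)"
  by (simp add: path_length_def count_law_def map_bind_pmf map_pmf_comp arc_counts_def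
      sum_length_filter_compl)

lemma count_law_Suc_0: "count_law (Suc 0) = return_pmf (1, 0)"
proof -
  have "out_arcs single_edge source = {0}" "tail single_edge 0 = source" "head single_edge 0 = sink"
    by (auto simp: out_arcs_def single_edge_def source_def sink_def)
  then have "random_path single_edge = return_pmf [0]"
    by (simp add: random_path_def single_edge_def source_def sink_def pmf_of_set_singleton bind_return_pmf)
  moreover have "arc_counts single_edge [0] = (1, 0)"
    using \<open>out_arcs single_edge source = {0}\<close> \<open>tail single_edge 0 = source\<close>
    by (simp add: arc_counts_def out_degree_def)
  ultimately show ?thesis by (simp add: count_law_def bind_return_pmf)
qed

lemma finite_count_law: "n \<ge> 1 \<Longrightarrow> finite (set_pmf (count_law n))"
  using finite_random_network finite_random_path random_network_sp_network
  by (auto simp: count_law_def)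

text \<open>Source and sink differ, and a path repeats no arc. The lower bound later absorbs the 1
  in \<open>1 + x + y\<close>; the upper bound controls the second moment of
  \<open>decay\<close>.\<close>

lemma count_law_bounds:
  assumes "n \<ge> 1" "(x, y) \<in> set_pmf (count_law n)"
  shows "1 \<le> x + y" "x + y \<le> n"
proof -
  obtain N p where N: "N \<in> set_pmf (random_network n)" and p: "p \<in> set_pmf (random_path N)"
    and xy: "(x, y) = arc_counts N p"
    using assms(2) by (auto simp: count_law_def)
  have sp: "sp_network N" "card (arcs N) = n" using random_network_sp_network[OF assms(1) N] by auto
  have len: "x + y = length p" using xy by (simp add: arc_counts_def sum_length_filter_compl)
  note path = random_path_arcs[OF sp(1) p]
  show "1 \<le> x + y" using path(3) len by (cases p) auto
  have "card (set p) \<le> card (arcs N)"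
    using path(1) sp_network_finite_arcs[OF sp(1)] by (intro card_mono) auto
  then show "x + y \<le> n" using len sp(2) distinct_card[OF path(2)] by simp
qed

text \<open>The arc to grow is chosen independently of the path in the old network. Exchanging the
  two choices fixes the path first, and \<open>sum_jump\<close> then averages over the arc.\<close>

lemma expectation_count_law_Suc:
  assumes n: "n \<ge> 1"
  shows "measure_pmf.expectation (count_law (Suc n)) h =
    measure_pmf.expectation (count_law n) (\<lambda>s. h s + generator h s / real n)"
proof -
  let ?q = "\<lambda>N. bind_pmf (pmf_of_set (arcs N)) (\<lambda>e. map_pmf (jump N e) (random_path N))"
  have sp: "sp_network N" "card (arcs N) = n" if "N \<in> set_pmf (random_network n)" for N
    using random_network_sp_network[OF n that] by auto
  have fin: "finite (set_pmf (?q N))" if "sp_network N" for N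
    using that finite_random_path sp_network_finite_arcs by auto
  have "count_law (Suc n) = bind_pmf (bind_pmf (random_network n) grow)
      (\<lambda>N. map_pmf (arc_counts N) (random_path N))"
    using n by (cases n) (auto simp: count_law_def)
  also have "\<dots> = bind_pmf (random_network n) ?q"
    unfolding bind_assoc_pmf grow_eq_map_grow_at bind_map_pmf
    using sp_network_finite_arcs sp map_pmf_arc_counts_grow_at by (intro bind_pmf_cong refl) auto
  finally have step: "count_law (Suc n) = bind_pmf (random_network n) ?q" .
  have "measure_pmf.expectation (?q N) h =
      measure_pmf.expectation (random_path N) (\<lambda>p. (h (arc_counts N p) + generator h (arc_counts N p) / real n))"
    if "N \<in> set_pmf (random_network n)" for N
  proof -
    note N = sp[OF that] and arcs = sp_network_finite_arcs[OF sp(1)[OF that]]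
    have "?q N = bind_pmf (random_path N) (\<lambda>p. map_pmf (\<lambda>e. jump N e p) (pmf_of_set (arcs N)))"
      unfolding map_pmf_def by (rule bind_commute_pmf)
    also have "measure_pmf.expectation \<dots> h =
        measure_pmf.expectation (random_path N) (\<lambda>p. (h (arc_counts N p) + generator h (arc_counts N p) / real n))"
    proof (rule expectation_bind_pmf_finite)
      fix p assume p: "p \<in> set_pmf (random_path N)"
      have "measure_pmf.expectation (map_pmf (\<lambda>e. jump N e p) (pmf_of_set (arcs N))) h =
          (\<Sum>e\<in>arcs N. h (jump N e p)) / real n"
        using arcs N by (simp add: integral_pmf_of_set)
      also have "\<dots> = h (arc_counts N p) + generator h (arc_counts N p) / real n"
        using sum_jump[OF N(1) random_path_arcs(1,2)[OF N(1) p], of h] n N(2)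
        by (simp add: field_simps)
      finally show "measure_pmf.expectation (map_pmf (\<lambda>e. jump N e p) (pmf_of_set (arcs N))) h =
          h (arc_counts N p) + generator h (arc_counts N p) / real n" .
    qed (use arcs finite_random_path[OF N(1)] in auto)
    finally show ?thesis .
  qed
  then have "measure_pmf.expectation (count_law (Suc n)) h =
      measure_pmf.expectation (random_network n) (\<lambda>N. measure_pmf.expectation (random_path N)
        (\<lambda>p. (h (arc_counts N p) + generator h (arc_counts N p) / real n)))"
    unfolding step using finite_random_network[OF n] fin sp by (intro expectation_bind_pmf_finite) auto
  also have "\<dots> = measure_pmf.expectation (count_law n) (\<lambda>s. h s + generator h s / real n)"
    unfolding count_law_def using finite_random_network[OF n] sp finite_random_path
    by (intro expectation_bind_pmf_finite[symmetric]) auto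
  finally show ?thesis .
qed

section \<open>Eigenfunctions of the generator\<close>

lemma phi_square: "\<phi> * \<phi> = 1 - \<phi>"
  by (simp add: \<phi>_def field_simps)

lemma phi_bounds: "1 / 2 < \<phi>" "\<phi> < 1"
proof -
  have "2 < sqrt 5" "sqrt 5 < 3" by (simp_all add: real_less_rsqrt real_less_lsqrt)
  then show "1 / 2 < \<phi>" "\<phi> < 1" by (simp_all add: \<phi>_def)
qed

lemma c_0 [simp]: "c 0 = 1" and c_1: "c (Suc 0) = (3 + \<phi>) / 5"
  by (simp_all add: c.simps)

lemma c_convolution:
  assumes r: "r \<ge> 2"
  shows "(\<Sum>k = 1..r - 1. (real k * \<phi> + 1) * c k * c (r - k)) =
    (real r - 1) * \<phi> * ((real r + 1) * \<phi> + 1) * c r"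
proof -
  have "(real r - 1) * \<phi> * ((real r + 1) * \<phi> + 1) \<noteq> 0"
    using r phi_bounds by (auto simp: add_nonneg_eq_0_iff)
  then show ?thesis using r by (subst (3) c.simps) auto
qed

lemma c_nonneg: "0 \<le> c r"
proof (induction r rule: less_induct)
  case (less r)
  show ?case
  proof (cases "r \<ge> 2")
    case True
    then show ?thesis using less phi_bounds
      by (subst c.simps) (auto intro!: mult_nonneg_nonneg divide_nonneg_nonneg sum_nonneg)
  next
    case False
    then have "r = 0 \<or> r = Suc 0" by auto
    then show ?thesis using phi_bounds by (auto simp: c_1)
  qed
qed

text \<open>Exponential growth of \<open>c\<close> is enough for the limiting moments to determine
  their distribution.\<close>

lemma c_bound: "c r \<le> 2 ^ r"
proof -
  \<comment> \<open>The factor \<open>\<phi>\<close> makes the induction close: with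
    \<open>real k * \<phi> + 1\<close> bounded by \<open>(real r + 1) * \<phi> + 1\<close>, the
    \<open>r - 1\<close> equal summands reproduce the denominator of the recursion and leave one
    \<open>\<phi>\<close>.\<close>
  have "c r \<le> \<phi> * 2 ^ r" if "r \<ge> 1" for r
    using that
  proof (induction r rule: less_induct)
    case (less r)
    show ?case
    proof (cases "r \<ge> 2")
      case True
      have pos: "0 < (real r - 1) * \<phi> * ((real r + 1) * \<phi> + 1)"
        using True phi_bounds by (intro mult_pos_pos add_nonneg_pos) auto
      have "(real r - 1) * \<phi> * ((real r + 1) * \<phi> + 1) * c r =
          (\<Sum>k = 1..r - 1. (real k * \<phi> + 1) * c k * c (r - k))"
        using c_convolution[OF True] by simp
      also have "\<dots> \<le> (\<Sum>k = 1..r - 1. ((real r + 1) * \<phi> + 1) * (\<phi> * 2 ^ k) * (\<phi> * 2 ^ (r - k)))"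
        using less.IH True phi_bounds
        by (intro sum_mono mult_mono c_nonneg mult_nonneg_nonneg add_right_mono mult_right_mono) auto
      also have "\<dots> = (\<Sum>k = 1..r - 1. ((real r + 1) * \<phi> + 1) * \<phi> * \<phi> * 2 ^ r)"
      proof (intro sum.cong refl)
        fix k assume "k \<in> {1..r - 1}"
        then have "k \<le> r" by auto
        then have "(2::real) ^ r = 2 ^ k * 2 ^ (r - k)" by (simp flip: power_add)
        then show "((real r + 1) * \<phi> + 1) * (\<phi> * 2 ^ k) * (\<phi> * 2 ^ (r - k)) =
            ((real r + 1) * \<phi> + 1) * \<phi> * \<phi> * 2 ^ r" by simp
      qed
      also have "\<dots> = (real r - 1) * \<phi> * ((real r + 1) * \<phi> + 1) * (\<phi> * 2 ^ r)"
        using True by (simp add: of_nat_diff)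
      finally show ?thesis using pos by (simp only: mult_le_cancel_left_pos)
    next
      case False
      then have "r = Suc 0" using less.prems by auto
      then show ?thesis using phi_bounds by (simp add: c_1)
    qed
  qed
  then have "r \<ge> 1 \<Longrightarrow> c r \<le> 1 * 2 ^ r"
    using phi_bounds by (meson less_imp_le mult_right_mono order_trans zero_le_numeral zero_le_power)
  then show ?thesis by (cases "r = 0") auto
qed

section \<open>Generating functions and their differential equations\<close>

definition F :: "real fps" where "F = Abs_fps c"

definition H :: "real fps" where "H = F + fps_const \<phi> * (fps_X * fps_deriv F)"

lemma F_nth [simp]: "fps_nth F r = c r"
  by (simp add: F_def)

lemma fps_X_deriv_nth: "fps_nth (fps_X * fps_deriv f) r = real r * fps_nth f r"
  by (cases r) auto

lemma H_nth: "fps_nth H r = (real r * \<phi> + 1) * c r"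
  by (simp add: H_def fps_X_deriv_nth algebra_simps)

lemma F_ode: "fps_const \<phi> * (fps_X * fps_deriv F) = H - F"
  by (simp add: H_def)

text \<open>The coefficients of \<open>H * F\<close> contain the convolution in the recursion for
  \<open>c\<close>. The extreme indices \<open>k = 0\<close> and \<open>k = r\<close> give the terms
  linear in \<open>c r\<close>, and \<open>\<phi> * \<phi> = 1 - \<phi>\<close> matches the
  polynomials in \<open>r\<close>.\<close>

lemma H_ode: "fps_const \<phi> * (fps_X * fps_deriv H) = H * F - H"
proof (rule fps_ext)
  fix r
  have conv: "fps_nth (H * F) r = (\<Sum>k = 0..r. (real k * \<phi> + 1) * c k * c (r - k))"
    by (simp add: fps_mult_nth H_nth)
  have "\<phi> * (real r * ((real r * \<phi> + 1) * c r)) = fps_nth (H * F) r - (real r * \<phi> + 1) * c r"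
  proof -
    consider "r = 0" | "r = Suc 0" | "r \<ge> 2" by linarith
    then show ?thesis
    proof cases
      case 2
      \<comment> \<open>In degree 1 the equation holds whatever \<open>c 1\<close> is: this value
        only sets the scale of the variable.\<close>
      have "\<phi> * (\<phi> + 1) = 1" using phi_square by (simp add: algebra_simps)
      then have "\<phi> * ((\<phi> + 1) * c 1) = c 1" by (simp only: mult.assoc[symmetric] mult_1)
      moreover have "fps_nth (H * F) 1 = c 1 + (\<phi> + 1) * c 1"
        using conv 2 by (simp add: algebra_simps)
      ultimately show ?thesis using 2 by simp
    next
      case 3
      have "{0..r} = insert 0 (insert r {1..r - 1})" using 3 by auto
      then have "fps_nth (H * F) r = c r + (real r * \<phi> + 1) * c r +
          (\<Sum>k = 1..r - 1. (real k * \<phi> + 1) * c k * c (r - k))"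
        using 3 unfolding conv by simp
      also have "\<dots> = c r + (real r * \<phi> + 1) * c r + (real r - 1) * \<phi> * ((real r + 1) * \<phi> + 1) * c r"
        by (simp only: c_convolution[OF 3])
      finally have "fps_nth (H * F) r - (real r * \<phi> + 1) * c r =
          (1 + (real r - 1) * \<phi> * ((real r + 1) * \<phi> + 1)) * c r"
        by (simp add: algebra_simps)
      also have "1 + (real r - 1) * \<phi> * ((real r + 1) * \<phi> + 1) =
          (real r * real r) * (\<phi> * \<phi>) + real r * \<phi> + (1 - \<phi> - \<phi> * \<phi>)"
        by (simp only: algebra_simps)
      also have "\<dots> = \<phi> * (real r * (real r * \<phi> + 1))"
        using phi_square by (simp add: algebra_simps)
      finally show ?thesis by simp
    qed (simp add: conv H_nth)
  qed
  then show "fps_nth (fps_const \<phi> * (fps_X * fps_deriv H)) r = fps_nth (H * F - H) r"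
    by (simp only: fps_mult_left_const_nth fps_X_deriv_nth fps_sub_nth H_nth)
qed

definition eig :: "nat \<Rightarrow> nat \<times> nat \<Rightarrow> real" where
  "eig r = (\<lambda>(x, y). fps_nth (F ^ x * H ^ y) r)"

lemma eig_start: "eig r (1, 0) = c r"
  by (simp add: eig_def)

lemma eig_0: "eig 0 s = 1"
  by (cases s) (simp add: eig_def fps_nth_power_0 H_nth)

lemma fps_deriv_mult_power:
  fixes f g :: "real fps"
  shows "fps_X * fps_deriv (f ^ x * g ^ y) =
    of_nat x * f ^ (x - 1) * g ^ y * (fps_X * fps_deriv f) +
    of_nat y * f ^ x * g ^ (y - 1) * (fps_X * fps_deriv g)"
  by (simp add: fps_deriv_power fps_of_nat algebra_simps)

text \<open>
  Multiplicativity of \<open>F ^ x * H ^ y\<close> is the branching property: every arc of the path evolves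
  independently, so being an eigenfunction reduces to the equations for a single arc,
  \<open>F_ode\<close> and \<open>H_ode\<close>.
\<close>

lemma generator_eig: "generator (eig r) s = \<phi> * real r * eig r s"
proof (cases s)
  case (Pair x y)
  have "fps_const \<phi> * (fps_X * fps_deriv (F ^ x * H ^ y)) =
      of_nat x * F ^ (x - 1) * H ^ y * (fps_const \<phi> * (fps_X * fps_deriv F)) +
      of_nat y * F ^ x * H ^ (y - 1) * (fps_const \<phi> * (fps_X * fps_deriv H))"
    unfolding fps_deriv_mult_power by (simp add: algebra_simps)
  also have "\<dots> = of_nat x * (F ^ (x - 1) * H ^ (y + 1) - F ^ (x - 1) * F * H ^ y) +
      of_nat y * (F ^ (x + 1) * (H ^ (y - 1) * H) - F ^ x * (H ^ (y - 1) * H))"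
    unfolding F_ode H_ode by (simp add: algebra_simps)
  \<comment> \<open>The exponents \<open>x - 1\<close> and \<open>y - 1\<close> are truncated only
    under a zero factor.\<close>
  also have "\<dots> = of_nat x * (F ^ (x - 1) * H ^ (y + 1) - F ^ x * H ^ y) +
      of_nat y * (F ^ (x + 1) * H ^ y - F ^ x * H ^ y)"
    by (cases x; cases y) (simp_all add: mult.commute)
  finally have "fps_nth (fps_const \<phi> * (fps_X * fps_deriv (F ^ x * H ^ y))) r =
      fps_nth (of_nat x * (F ^ (x - 1) * H ^ (y + 1) - F ^ x * H ^ y) +
      of_nat y * (F ^ (x + 1) * H ^ y - F ^ x * H ^ y)) r" by simp
  then show ?thesis
    unfolding fps_mult_left_const_nth fps_X_deriv_nth Pair generator_def eig_def
    by (simp add: fps_of_nat[symmetric] del: fps_of_nat power_Suc)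
qed

section \<open>Leading terms of the eigenfunctions\<close>

definition log_deriv :: "real fps \<Rightarrow> real fps" where
  "log_deriv f = fps_X * fps_deriv f * inverse f"

text \<open>The coefficient of degree \<open>i\<close> in \<open>log_deriv\<close> of
  \<open>F ^ x * H ^ y\<close>, which is linear in the exponents.\<close>

definition lin :: "nat \<Rightarrow> nat \<times> nat \<Rightarrow> real" where
  "lin i = (\<lambda>(x, y). real x * fps_nth (log_deriv F) i + real y * fps_nth (log_deriv H) i)"

lemma log_deriv_mult:
  assumes "fps_nth f 0 \<noteq> 0"
  shows "fps_X * fps_deriv f = log_deriv f * f"
  using inverse_mult_eq_1[OF assms] by (simp add: log_deriv_def mult.assoc)

text \<open>Multiplying \<open>F ^ x * H ^ y\<close> by its \<open>log_deriv\<close> multiplies the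
  coefficient of degree \<open>r\<close> by \<open>r\<close>. The term \<open>i = 0\<close>
  vanishes, so only lower orders of \<open>eig\<close> occur.\<close>

lemma eig_recursion: "real r * eig r s = (\<Sum>i = 1..r. lin i s * eig (r - i) s)"
proof (cases s)
  case (Pair x y)
  have x: "of_nat x * F ^ (x - 1) * F = of_nat x * F ^ x" by (cases x) auto
  have y: "of_nat y * H ^ (y - 1) * H = of_nat y * H ^ y" by (cases y) auto
  have "fps_X * fps_deriv (F ^ x * H ^ y) =
      (of_nat x * F ^ (x - 1) * F) * H ^ y * log_deriv F +
      F ^ x * (of_nat y * H ^ (y - 1) * H) * log_deriv H"
    unfolding fps_deriv_mult_power by (simp add: log_deriv_mult H_nth algebra_simps)
  also have "\<dots> = (of_nat x * log_deriv F + of_nat y * log_deriv H) * (F ^ x * H ^ y)"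
    unfolding x y by (simp add: algebra_simps)
  finally have "fps_nth (fps_X * fps_deriv (F ^ x * H ^ y)) r =
      fps_nth ((of_nat x * log_deriv F + of_nat y * log_deriv H) * (F ^ x * H ^ y)) r" by simp
  then have "real r * eig r s = (\<Sum>i = 0..r. lin i s * eig (r - i) s)"
    unfolding fps_X_deriv_nth Pair eig_def lin_def
    by (simp add: fps_mult_nth[of _ "F ^ x * H ^ y"] fps_of_nat[symmetric] del: fps_of_nat)
  moreover have "lin 0 s = 0" by (simp add: Pair lin_def log_deriv_def)
  ultimately show ?thesis by (simp add: sum.atLeast_Suc_atMost)
qed

text \<open>The weights \<open>c 1\<close> and \<open>c 1 * (1 + \<phi>)\<close> are the degree 1
  coefficients of \<open>F\<close> and \<open>H\<close>, so this is \<open>eig 1\<close>.\<close>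

definition lead :: "nat \<times> nat \<Rightarrow> real" where
  "lead = (\<lambda>(x, y). c 1 * (real x + (1 + \<phi>) * real y))"

lemma lin_1: "lin 1 s = lead s"
  by (cases s) (simp add: lin_def lead_def log_deriv_def fps_mult_nth H_nth algebra_simps)

text \<open>The base is at least 1, even at the origin, so a bound of degree \<open>k\<close> is
  also one of any higher degree.\<close>

definition poly_bounded :: "nat \<Rightarrow> (nat \<times> nat \<Rightarrow> real) \<Rightarrow> bool" where
  "poly_bounded k h \<longleftrightarrow> (\<exists>C \<ge> 0. \<forall>x y. \<bar>h (x, y)\<bar> \<le> C * (1 + real x + real y) ^ k)"

lemma poly_bounded_mono:
  assumes "poly_bounded k h" "k \<le> l"
  shows "poly_bounded l h"
proof -
  obtain C where C: "C \<ge> 0" "\<And>x y. \<bar>h (x, y)\<bar> \<le> C * (1 + real x + real y) ^ k"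
    using assms(1) unfolding poly_bounded_def by blast
  have "\<bar>h (x, y)\<bar> \<le> C * (1 + real x + real y) ^ l" for x y
    using C(2)[of x y] mult_left_mono[OF power_increasing[OF assms(2), of "1 + real x + real y"] C(1)]
    by linarith
  then show ?thesis using C(1) unfolding poly_bounded_def by blast
qed

lemma poly_bounded_mult:
  assumes "poly_bounded k h" "poly_bounded l g"
  shows "poly_bounded (k + l) (\<lambda>s. h s * g s)"
proof -
  obtain C where C: "C \<ge> 0" "\<And>x y. \<bar>h (x, y)\<bar> \<le> C * (1 + real x + real y) ^ k"
    using assms(1) unfolding poly_bounded_def by blast
  obtain D where D: "D \<ge> 0" "\<And>x y. \<bar>g (x, y)\<bar> \<le> D * (1 + real x + real y) ^ l"
    using assms(2) unfolding poly_bounded_def by blast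
  have "\<bar>h (x, y) * g (x, y)\<bar> \<le> (C * D) * (1 + real x + real y) ^ (k + l)" for x y
    using mult_mono[OF C(2)[of x y] D(2)[of x y]] C(1)
    by (simp add: abs_mult power_add ac_simps)
  then show ?thesis using C(1) D(1) unfolding poly_bounded_def
    by (intro exI[of _ "C * D"]) auto
qed

lemma poly_bounded_add:
  assumes "poly_bounded k h" "poly_bounded k g"
  shows "poly_bounded k (\<lambda>s. h s + g s)"
proof -
  obtain C where C: "C \<ge> 0" "\<And>x y. \<bar>h (x, y)\<bar> \<le> C * (1 + real x + real y) ^ k"
    using assms(1) unfolding poly_bounded_def by blast
  obtain D where D: "D \<ge> 0" "\<And>x y. \<bar>g (x, y)\<bar> \<le> D * (1 + real x + real y) ^ k"
    using assms(2) unfolding poly_bounded_def by blast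
  have "\<bar>h (x, y) + g (x, y)\<bar> \<le> (C + D) * (1 + real x + real y) ^ k" for x y
    using C(2)[of x y] D(2)[of x y] unfolding distrib_right by linarith
  then show ?thesis using C(1) D(1) unfolding poly_bounded_def
    by (intro exI[of _ "C + D"]) auto
qed

lemma poly_bounded_const: "poly_bounded 0 (\<lambda>s. a)"
  unfolding poly_bounded_def by (intro exI[of _ "\<bar>a\<bar>"]) auto

lemma poly_bounded_cmult: "poly_bounded k h \<Longrightarrow> poly_bounded k (\<lambda>s. a * h s)"
  using poly_bounded_mult[OF poly_bounded_const] by simp

lemma poly_bounded_sum:
  assumes "\<And>i. i \<in> I \<Longrightarrow> poly_bounded k (h i)"
  shows "poly_bounded k (\<lambda>s. \<Sum>i\<in>I. h i s)"
  using assms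
proof (induction I rule: infinite_finite_induct)
  case (insert i I)
  then show ?case by (simp add: poly_bounded_add)
qed (use poly_bounded_mono[OF poly_bounded_const[of 0]] in auto)

lemma poly_bounded_lin: "poly_bounded 1 (lin i)"
  unfolding poly_bounded_def
proof (intro exI conjI allI)
  let ?a = "fps_nth (log_deriv F) i" and ?b = "fps_nth (log_deriv H) i"
  show "0 \<le> \<bar>?a\<bar> + \<bar>?b\<bar>" by simp
  fix x y
  have "\<bar>lin i (x, y)\<bar> \<le> real x * \<bar>?a\<bar> + real y * \<bar>?b\<bar>"
    unfolding lin_def using abs_triangle_ineq[of "real x * ?a" "real y * ?b"] by (simp add: abs_mult)
  also have "\<dots> \<le> (\<bar>?a\<bar> + \<bar>?b\<bar>) * (1 + real x + real y) ^ 1"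
    by (simp add: algebra_simps add_increasing)
  finally show "\<bar>lin i (x, y)\<bar> \<le> (\<bar>?a\<bar> + \<bar>?b\<bar>) * (1 + real x + real y) ^ 1" .
qed

text \<open>In \<open>eig_recursion\<close> each linear factor comes with an order lowered by at
  least one, so the degree never exceeds the order.\<close>

lemma poly_bounded_eig: "poly_bounded r (eig r)"
proof (induction r rule: less_induct)
  case (less r)
  show ?case
  proof (cases "r = 0")
    case True
    have "eig 0 = (\<lambda>s. 1)" by (rule ext) (rule eig_0)
    then show ?thesis using True poly_bounded_const[of 1] by simp
  next
    case False
    have "poly_bounded r (\<lambda>s. \<Sum>i = 1..r. lin i s * eig (r - i) s)"
    proof (rule poly_bounded_sum)
      fix i assume i: "i \<in> {1..r}"
      then have "poly_bounded (1 + (r - i)) (\<lambda>s. lin i s * eig (r - i) s)"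
        by (intro poly_bounded_mult poly_bounded_lin less.IH) auto
      then show "poly_bounded r (\<lambda>s. lin i s * eig (r - i) s)"
        by (rule poly_bounded_mono) (use i in auto)
    qed
    then have "poly_bounded r (\<lambda>s. (1 / real r) * (real r * eig r s))"
      unfolding eig_recursion by (rule poly_bounded_cmult)
    then show ?thesis using False by simp
  qed
qed

text \<open>Modulo lower degree only the term \<open>i = 1\<close> of \<open>eig_recursion\<close>
  counts. It multiplies by \<open>lead\<close> and divides by the order, which produces the
  factorial.\<close>

lemma eig_leading: "poly_bounded r (\<lambda>s. eig (Suc r) s - lead s ^ Suc r / fact (Suc r))"
proof (induction r)
  case 0
  have "eig (Suc 0) s - lead s ^ Suc 0 / fact (Suc 0) = 0" for s
    using eig_recursion[of "Suc 0" s] lin_1[of s] by (simp add: eig_0)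
  then show ?case using poly_bounded_const[of 0] by simp
next
  case (Suc r)
  have "poly_bounded (Suc r) (\<lambda>s. \<Sum>i = 2..Suc (Suc r). lin i s * eig (Suc (Suc r) - i) s)"
  proof (rule poly_bounded_sum)
    fix i assume i: "i \<in> {2..Suc (Suc r)}"
    have "poly_bounded (1 + (Suc (Suc r) - i)) (\<lambda>s. lin i s * eig (Suc (Suc r) - i) s)"
      by (intro poly_bounded_mult poly_bounded_lin poly_bounded_eig)
    then show "poly_bounded (Suc r) (\<lambda>s. lin i s * eig (Suc (Suc r) - i) s)"
      by (rule poly_bounded_mono) (use i in auto)
  qed
  moreover have "poly_bounded (1 + r) (\<lambda>s. lin 1 s * (eig (Suc r) s - lead s ^ Suc r / fact (Suc r)))"
    by (intro poly_bounded_mult poly_bounded_lin Suc.IH)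
  ultimately have "poly_bounded (Suc r) (\<lambda>s. (1 / real (Suc (Suc r))) *
      (lin 1 s * (eig (Suc r) s - lead s ^ Suc r / fact (Suc r)) +
       (\<Sum>i = 2..Suc (Suc r). lin i s * eig (Suc (Suc r) - i) s)))"
    by (intro poly_bounded_cmult poly_bounded_add) simp_all
  moreover have "(1 / real (Suc (Suc r))) *
      (lin 1 s * (eig (Suc r) s - lead s ^ Suc r / fact (Suc r)) +
       (\<Sum>i = 2..Suc (Suc r). lin i s * eig (Suc (Suc r) - i) s)) =
      eig (Suc (Suc r)) s - lead s ^ Suc (Suc r) / fact (Suc (Suc r))" for s
  proof -
    have cancel: "a * (u - v / (a * w)) = a * u - v / w" if "a \<noteq> 0" for a u v w :: real
      using that by (simp add: right_diff_distrib)
    have "real (Suc (Suc r)) * eig (Suc (Suc r)) s =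
        lin 1 s * eig (Suc r) s + (\<Sum>i = 2..Suc (Suc r). lin i s * eig (Suc (Suc r) - i) s)"
      unfolding eig_recursion[of "Suc (Suc r)"] by (subst sum.atLeast_Suc_atMost) (auto simp: numeral_2_eq_2)
    then have "lin 1 s * (eig (Suc r) s - lead s ^ Suc r / fact (Suc r)) +
        (\<Sum>i = 2..Suc (Suc r). lin i s * eig (Suc (Suc r) - i) s) =
        real (Suc (Suc r)) * eig (Suc (Suc r)) s - lead s ^ Suc (Suc r) / fact (Suc r)"
      unfolding lin_1 by (simp add: algebra_simps)
    also have "\<dots> = real (Suc (Suc r)) * (eig (Suc (Suc r)) s - lead s ^ Suc (Suc r) / fact (Suc (Suc r)))"
      unfolding fact_Suc[of "Suc r"] by (rule cancel[symmetric]) simp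
    finally show ?thesis by simp
  qed
  ultimately show ?case by simp
qed

section \<open>Asymptotics of the moments\<close>

abbreviation expect :: "nat \<Rightarrow> (nat \<times> nat \<Rightarrow> real) \<Rightarrow> real" where
  "expect n h \<equiv> measure_pmf.expectation (count_law n) h"

lemma integrable_count_law: "n \<ge> 1 \<Longrightarrow> integrable (measure_pmf (count_law n)) (h :: nat \<times> nat \<Rightarrow> real)"
  by (intro integrable_measure_pmf_finite finite_count_law)

lemma expect_mono:
  assumes "n \<ge> 1" "\<And>x y. 1 \<le> x + y \<Longrightarrow> x + y \<le> n \<Longrightarrow> h (x, y) \<le> g (x, y)"
  shows "expect n h \<le> expect n g"
  using assms count_law_bounds
  by (intro integral_mono_AE integrable_count_law) (auto simp: AE_measure_pmf_iff)

lemma abs_expect_le: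
  assumes "n \<ge> 1" "\<And>x y. 1 \<le> x + y \<Longrightarrow> x + y \<le> n \<Longrightarrow> \<bar>h (x, y)\<bar> \<le> g (x, y)"
  shows "\<bar>expect n h\<bar> \<le> expect n g"
proof -
  have "\<bar>expect n h\<bar> \<le> expect n (\<lambda>s. \<bar>h s\<bar>)" by (rule integral_abs_bound)
  also have "\<dots> \<le> expect n g" using assms by (intro expect_mono) auto
  finally show ?thesis .
qed

text \<open>The step from size \<open>k\<close> multiplies the expectation by
  \<open>1 + \<mu> / k\<close>. Size \<open>Suc n\<close> is reached after \<open>n\<close> steps
  from the state \<open>(1, 0)\<close>.\<close>

lemma expect_eigenfunction:
  assumes gen: "\<And>s. generator h s = \<mu> * h s"
  shows "expect (Suc n) h = h (1, 0) * pochhammer (1 + \<mu>) n / fact n"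
proof (induction n)
  case 0
  show ?case by (simp add: count_law_Suc_0)
next
  case (Suc n)
  have "expect (Suc (Suc n)) h = expect (Suc n) (\<lambda>s. (1 + \<mu> / real (Suc n)) * h s)"
    by (subst expectation_count_law_Suc) (simp_all add: gen algebra_simps)
  also have "\<dots> = (1 + \<mu> / real (Suc n)) * (h (1, 0) * pochhammer (1 + \<mu>) n / fact n)"
    by (simp only: integral_mult_right_zero Suc.IH)
  also have "\<dots> = h (1, 0) * pochhammer (1 + \<mu>) (Suc n) / fact (Suc n)"
  proof -
    have "1 + \<mu> / real (Suc n) = (1 + \<mu> + real n) / real (Suc n)" by (simp add: field_simps)
    then show ?thesis by (simp add: pochhammer_Suc)
  qed
  finally show ?case .
qed

lemma pochhammer_asymptotic:
  assumes "\<mu> \<ge> 0"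
  shows "(\<lambda>n. pochhammer (1 + \<mu>) n / fact n / real (Suc n) powr \<mu>) \<longlonglongrightarrow> 1 / Gamma (\<mu> + 1)"
proof -
  have lim1: "(\<lambda>n. rGamma_series (1 + \<mu>) n) \<longlonglongrightarrow> 1 / Gamma (\<mu> + 1)"
    using rGamma_series_LIMSEQ[of "1 + \<mu>"] by (simp add: rGamma_inverse_Gamma inverse_eq_divide add.commute)
  \<comment> \<open>The first factor removes the last of the \<open>n + 1\<close> Pochhammer factors
    in \<open>rGamma_series\<close> together with a factor \<open>n\<close> of its normalization.
    The second turns \<open>n powr \<mu>\<close> into \<open>(n + 1) powr \<mu>\<close>, the size
    after \<open>n\<close> steps being \<open>n + 1\<close>.\<close>
  have lim2: "(\<lambda>n. (real n / (real n + 1 + \<mu>)) * (real n / (real n + 1)) powr \<mu>) \<longlonglongrightarrow> 1"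
    by real_asymp
  have "(\<lambda>n. rGamma_series (1 + \<mu>) n * ((real n / (real n + 1 + \<mu>)) * (real n / (real n + 1)) powr \<mu>))
      \<longlonglongrightarrow> 1 / Gamma (\<mu> + 1) * 1"
    by (intro tendsto_mult lim1 lim2)
  moreover have "\<forall>\<^sub>F n in sequentially.
      rGamma_series (1 + \<mu>) n * ((real n / (real n + 1 + \<mu>)) * (real n / (real n + 1)) powr \<mu>) =
      pochhammer (1 + \<mu>) n / fact n / real (Suc n) powr \<mu>"
    using eventually_gt_at_top[of 0]
  proof eventually_elim
    case (elim n)
    define p where "p = pochhammer (1 + \<mu>) n / fact n"
    have "exp ((1 + \<mu>) * of_real (ln (of_nat n))) = real n * real n powr \<mu>"
      using elim by (simp add: distrib_right exp_add powr_def)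
    then have "rGamma_series (1 + \<mu>) n = p * (1 + \<mu> + real n) / (real n * real n powr \<mu>)"
      by (simp add: rGamma_series_def pochhammer_Suc p_def)
    moreover have "(real n / (real n + 1)) powr \<mu> = real n powr \<mu> / real (Suc n) powr \<mu>"
      by (simp add: powr_divide add.commute)
    ultimately have "rGamma_series (1 + \<mu>) n * ((real n / (real n + 1 + \<mu>)) * (real n / (real n + 1)) powr \<mu>) =
        p * (1 + \<mu> + real n) / (real n * real n powr \<mu>) * (real n / (1 + \<mu> + real n) * (real n powr \<mu> / real (Suc n) powr \<mu>))"
      by (simp add: add_ac)
    also have "\<dots> = p / real (Suc n) powr \<mu>"
      using elim assms by simp
    finally show ?case unfolding p_def .
  qed
  ultimately show ?thesis by (auto elim: Lim_transform_eventually)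
qed

lemma expect_eig_asymptotic:
  "(\<lambda>n. expect n (eig r) / real n powr (real r * \<phi>)) \<longlonglongrightarrow> c r / Gamma (real r * \<phi> + 1)"
proof (rule LIMSEQ_imp_Suc)
  have "(\<lambda>n. c r * (pochhammer (1 + real r * \<phi>) n / fact n / real (Suc n) powr (real r * \<phi>)))
      \<longlonglongrightarrow> c r * (1 / Gamma (real r * \<phi> + 1))"
    using phi_bounds by (intro tendsto_mult tendsto_const pochhammer_asymptotic) auto
  moreover have "expect (Suc n) (eig r) = c r * pochhammer (1 + real r * \<phi>) n / fact n" for n
    using expect_eigenfunction[of "eig r" "real r * \<phi>" n] generator_eig eig_start[of r]
    by (simp add: mult.commute)
  ultimately show "(\<lambda>n. expect (Suc n) (eig r) / real (Suc n) powr (real r * \<phi>))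
      \<longlonglongrightarrow> c r / Gamma (real r * \<phi> + 1)"
    by (simp del: of_nat_Suc)
qed

section \<open>The path length and the two linear eigenfunctions\<close>

definition len :: "nat \<times> nat \<Rightarrow> real" where
  "len = (\<lambda>(x, y). real x + real y)"

text \<open>The linear eigenfunction with eigenvalue \<open>- 1 - \<phi>\<close>, scaled to be 1 at
  the start \<open>(1, 0)\<close>.\<close>

definition decay :: "nat \<times> nat \<Rightarrow> real" where
  "decay = (\<lambda>(x, y). real x - \<phi> * real y)"

lemma c1_bounds: "1 / 2 < c 1" "c 1 < 1"
  using phi_bounds by (simp_all add: c_1)

lemma len_le_lead: "len s \<le> 2 * lead s" and lead_nonneg: "0 \<le> lead s"
proof -
  obtain x y where s: "s = (x, y)" by force
  have "2 * c 1 * (real x + (1 + \<phi>) * real y) \<ge> 1 * (real x + 1 * real y)"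
    using c1_bounds phi_bounds by (intro mult_mono add_mono mult_right_mono) auto
  then show "len s \<le> 2 * lead s" by (simp add: s len_def lead_def)
  then show "0 \<le> lead s" by (simp add: s len_def)
qed

lemma lead_le_len: "lead s \<le> 2 * len s"
proof -
  obtain x y where s: "s = (x, y)" by force
  have "c 1 * (real x + (1 + \<phi>) * real y) \<le> 1 * (2 * real x + 2 * real y)"
    using c1_bounds phi_bounds by (intro mult_mono add_mono mult_right_mono) auto
  then show ?thesis by (simp add: s lead_def len_def)
qed

text \<open>This fixes \<open>c 1\<close>. The weights of \<open>x\<close> agree for any value;
  those of \<open>y\<close> force \<open>c 1 = (1 + \<phi>) / (1 + 2 * \<phi>)\<close>, which is
  \<open>(3 + \<phi>) / 5\<close>.\<close>

lemma len_decomposition: "len s = lead s + (1 - c 1) * decay s"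
proof -
  obtain x y where s: "s = (x, y)" by force
  have "c 1 * (1 + \<phi>) - (1 - c 1) * \<phi> = 1"
    using phi_square by (simp add: c_1 field_simps)
  then have "real y * (c 1 * (1 + \<phi>) - (1 - c 1) * \<phi>) = real y" by simp
  then show ?thesis by (simp add: s len_def lead_def decay_def algebra_simps)
qed

text \<open>Paths are nonempty, so \<open>1 + x + y\<close> is at most \<open>2 * len\<close> and
  hence at most \<open>4 * lead\<close>. Moments of \<open>lead\<close>, unlike powers of
  \<open>n\<close>, have the right order \<open>n powr (k * \<phi>)\<close>.\<close>

lemma expect_poly_bounded:
  assumes "poly_bounded k h"
  obtains C where "C \<ge> 0" "\<And>n. n \<ge> 1 \<Longrightarrow> \<bar>expect n h\<bar> \<le> C * expect n (\<lambda>s. lead s ^ k)"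
proof -
  obtain C where C: "C \<ge> 0" "\<And>x y. \<bar>h (x, y)\<bar> \<le> C * (1 + real x + real y) ^ k"
    using assms unfolding poly_bounded_def by blast
  have "\<bar>expect n h\<bar> \<le> C * 4 ^ k * expect n (\<lambda>s. lead s ^ k)" if "n \<ge> 1" for n
  proof -
    have "\<bar>expect n h\<bar> \<le> expect n (\<lambda>s. C * 4 ^ k * lead s ^ k)"
    proof (rule abs_expect_le[OF that])
      fix x y :: nat assume "1 \<le> x + y"
      then have "1 + real x + real y \<le> 4 * lead (x, y)"
        using len_le_lead[of "(x, y)"] by (simp add: len_def)
      then have "(1 + real x + real y) ^ k \<le> 4 ^ k * lead (x, y) ^ k"
        unfolding power_mult_distrib[symmetric] by (intro power_mono) auto
      then show "\<bar>h (x, y)\<bar> \<le> C * 4 ^ k * lead (x, y) ^ k"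
        using C(2)[of x y] mult_left_mono[OF _ C(1)] by (fastforce simp: mult.assoc)
    qed
    then show ?thesis by simp
  qed
  then show thesis using that[of "C * 4 ^ k"] C(1) by auto
qed

abbreviation (input) limit_moment :: "nat \<Rightarrow> real" where
  "limit_moment r \<equiv> fact r * c r / Gamma (real r * \<phi> + 1)"

text \<open>The expectation of \<open>eig (Suc r)\<close> is known, and by
  \<open>eig_leading\<close> its distance from \<open>lead ^ Suc r / fact (Suc r)\<close> has degree
  \<open>r\<close>. By induction the mean of that error is smaller by a factor of order
  \<open>n powr \<phi>\<close>.\<close>

lemma lead_moments:
  "(\<lambda>n. expect n (\<lambda>s. lead s ^ r) / real n powr (real r * \<phi>)) \<longlonglongrightarrow> limit_moment r"
proof (induction r)
  case 0
  \<comment> \<open>\<open>0 powr 0\<close> is \<open>0\<close>, so the ratio is 1 only from size 1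
    on.\<close>
  have "\<forall>\<^sub>F n in sequentially. expect n (\<lambda>s. lead s ^ 0) / real n powr (real 0 * \<phi>) = 1"
    using eventually_gt_at_top[of 0] by eventually_elim simp
  then show ?case by (simp add: tendsto_eventually)
next
  case (Suc r)
  let ?err = "\<lambda>s. eig (Suc r) s - lead s ^ Suc r / fact (Suc r)"
  obtain C where C: "C \<ge> 0" "\<And>n. n \<ge> 1 \<Longrightarrow> \<bar>expect n ?err\<bar> \<le> C * expect n (\<lambda>s. lead s ^ r)"
    using expect_poly_bounded[OF eig_leading] by blast
  have powr_Suc: "real n powr (real (Suc r) * \<phi>) = real n powr (real r * \<phi>) * real n powr \<phi>" for n
    unfolding powr_add[symmetric] by (simp add: algebra_simps)
  have "(\<lambda>n. expect n ?err / real n powr (real (Suc r) * \<phi>)) \<longlonglongrightarrow> 0"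
  proof (rule Lim_null_comparison)
    show "\<forall>\<^sub>F n in sequentially. norm (expect n ?err / real n powr (real (Suc r) * \<phi>)) \<le>
        C * (expect n (\<lambda>s. lead s ^ r) / real n powr (real r * \<phi>)) * (1 / real n powr \<phi>)"
      using eventually_ge_at_top[of 1]
    proof eventually_elim
      case (elim n)
      have "norm (expect n ?err / real n powr (real (Suc r) * \<phi>)) \<le>
          C * expect n (\<lambda>s. lead s ^ r) / real n powr (real (Suc r) * \<phi>)"
        using divide_right_mono[OF C(2)[OF elim], of "real n powr (real (Suc r) * \<phi>)"]
        by (simp add: abs_divide)
      also have "\<dots> = C * (expect n (\<lambda>s. lead s ^ r) / real n powr (real r * \<phi>)) * (1 / real n powr \<phi>)"
        unfolding powr_Suc by simp
      finally show ?case .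
    qed
    have "(\<lambda>n. 1 / real n powr \<phi>) \<longlonglongrightarrow> 0"
      using phi_bounds by real_asymp
    then have "(\<lambda>n. C * (expect n (\<lambda>s. lead s ^ r) / real n powr (real r * \<phi>)) * (1 / real n powr \<phi>))
        \<longlonglongrightarrow> C * limit_moment r * 0"
      by (intro tendsto_mult tendsto_const Suc.IH)
    then show "(\<lambda>n. C * (expect n (\<lambda>s. lead s ^ r) / real n powr (real r * \<phi>)) * (1 / real n powr \<phi>))
        \<longlonglongrightarrow> 0" by simp
  qed
  then have "(\<lambda>n. fact (Suc r) * (expect n (eig (Suc r)) / real n powr (real (Suc r) * \<phi>) -
      expect n ?err / real n powr (real (Suc r) * \<phi>)))
      \<longlonglongrightarrow> fact (Suc r) * (c (Suc r) / Gamma (real (Suc r) * \<phi> + 1) - 0)"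
    by (intro tendsto_mult tendsto_diff tendsto_const expect_eig_asymptotic)
  moreover have "\<forall>\<^sub>F n in sequentially.
      fact (Suc r) * (expect n (eig (Suc r)) / real n powr (real (Suc r) * \<phi>) -
        expect n ?err / real n powr (real (Suc r) * \<phi>)) =
      expect n (\<lambda>s. lead s ^ Suc r) / real n powr (real (Suc r) * \<phi>)"
    using eventually_ge_at_top[of 1]
  proof eventually_elim
    case (elim n)
    have "expect n ?err = expect n (eig (Suc r)) - expect n (\<lambda>s. lead s ^ Suc r) / fact (Suc r)"
      using elim by (subst Bochner_Integration.integral_diff) (auto intro: integrable_count_law simp del: power_Suc fact_Suc)
    then show ?case by (simp add: diff_divide_distrib del: power_Suc fact_Suc of_nat_Suc)
  qed
  ultimately show ?case
    by (auto elim: Lim_transform_eventually simp del: power_Suc fact_Suc of_nat_Suc)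
qed

text \<open>The drift pulls \<open>decay\<close> towards zero and only lowers its square. What
  remains are the squared jumps, \<open>(1 + \<phi>)\<^sup>2 = 2 + \<phi> < 3\<close> and 1, so each
  step adds at most 3 to the mean.\<close>

lemma expect_decay_square: "expect (Suc n) (\<lambda>s. decay s ^ 2) \<le> 1 + 3 * real n"
proof (induction n)
  case 0
  show ?case by (simp add: count_law_Suc_0 decay_def)
next
  case (Suc n)
  have "expect (Suc (Suc n)) (\<lambda>s. decay s ^ 2) =
      expect (Suc n) (\<lambda>s. decay s ^ 2 + generator (\<lambda>s. decay s ^ 2) s / real (Suc n))"
    by (rule expectation_count_law_Suc) simp
  also have "\<dots> \<le> expect (Suc n) (\<lambda>s. decay s ^ 2 + 3)"
  proof (rule expect_mono)
    fix x y :: nat assume xy: "x + y \<le> Suc n"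
    define q where "q = decay (x, y)"
    have 1: "real x * (decay (x - 1, y + 1) ^ 2 - q ^ 2) = real x * ((q - 1 - \<phi>) ^ 2 - q ^ 2)"
      by (cases x) (simp_all add: q_def decay_def algebra_simps)
    have 2: "decay (x + 1, y) = q + 1" by (simp add: q_def decay_def)
    have "generator (\<lambda>s. decay s ^ 2) (x, y) =
        real x * ((q - 1 - \<phi>) ^ 2 - q ^ 2) + real y * ((q + 1) ^ 2 - q ^ 2)"
      unfolding generator_def using 1 2 by (simp add: q_def)
    also have "\<dots> = - 2 * q * ((1 + \<phi>) * real x - real y) + (1 + \<phi>) ^ 2 * real x + real y"
      by (simp add: power2_eq_square algebra_simps)
    also have "(1 + \<phi>) * real x - real y = (1 + \<phi>) * q"
    proof -
      have "(1 + \<phi>) * \<phi> = 1" using phi_square by (simp add: algebra_simps)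
      moreover have "(1 + \<phi>) * q = (1 + \<phi>) * real x - ((1 + \<phi>) * \<phi>) * real y"
        by (simp add: q_def decay_def algebra_simps)
      ultimately show ?thesis by simp
    qed
    also have "- 2 * q * ((1 + \<phi>) * q) + (1 + \<phi>) ^ 2 * real x + real y \<le> 3 * real x + 3 * real y"
    proof -
      have "(1 + \<phi>) ^ 2 = 2 + \<phi>" using phi_square by (simp add: power2_eq_square algebra_simps)
      then have "(1 + \<phi>) ^ 2 * real x \<le> 3 * real x" using phi_bounds by (intro mult_right_mono) auto
      moreover have "0 \<le> (1 + \<phi>) * (q * q)" by (rule mult_nonneg_nonneg) (use phi_bounds in auto)
      moreover have "- 2 * q * ((1 + \<phi>) * q) = - 2 * ((1 + \<phi>) * (q * q))" by simp
      ultimately show ?thesis by linarith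
    qed
    also have "\<dots> \<le> 3 * real (Suc n)" using xy by simp
    finally have "generator (\<lambda>s. decay s ^ 2) (x, y) / real (Suc n) \<le> 3"
      by (simp add: divide_le_eq)
    then show "decay (x, y) ^ 2 + generator (\<lambda>s. decay s ^ 2) (x, y) / real (Suc n) \<le> decay (x, y) ^ 2 + 3" by simp
  qed simp
  also have "\<dots> = expect (Suc n) (\<lambda>s. decay s ^ 2) + 3"
    by (subst Bochner_Integration.integral_add) (auto intro: integrable_count_law)
  finally show ?case using Suc.IH by simp
qed

lemma power_diff_bound:
  fixes a b M :: real
  assumes "0 \<le> a" "a \<le> M" "0 \<le> b" "b \<le> M"
  shows "\<bar>a ^ Suc r - b ^ Suc r\<bar> \<le> real (Suc r) * (\<bar>a - b\<bar> * M ^ r)"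
proof (induction r)
  case (Suc r)
  have "a ^ Suc (Suc r) - b ^ Suc (Suc r) = a * (a ^ Suc r - b ^ Suc r) + (a - b) * b ^ Suc r"
    by (simp add: algebra_simps)
  then have "\<bar>a ^ Suc (Suc r) - b ^ Suc (Suc r)\<bar> \<le> a * \<bar>a ^ Suc r - b ^ Suc r\<bar> + \<bar>a - b\<bar> * b ^ Suc r"
    using abs_triangle_ineq[of "a * (a ^ Suc r - b ^ Suc r)" "(a - b) * b ^ Suc r"] assms
    by (simp add: abs_mult power_abs)
  also have "\<dots> \<le> M * (real (Suc r) * (\<bar>a - b\<bar> * M ^ r)) + \<bar>a - b\<bar> * M ^ Suc r"
    using assms Suc.IH by (intro add_mono mult_mono mult_left_mono power_mono) auto
  also have "\<dots> = real (Suc (Suc r)) * (\<bar>a - b\<bar> * M ^ Suc r)" by (simp add: algebra_simps)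
  finally show ?case .
qed simp

text \<open>The difference of the powers is at most a multiple of
  \<open>\<bar>decay\<bar> * lead ^ k\<close>. A weighted inequality of arithmetic and geometric
  means splits this product into the second moment of \<open>decay\<close> and the moment of order
  \<open>2 * k\<close> of \<open>lead\<close>.\<close>

lemma len_moments:
  "(\<lambda>n. expect n (\<lambda>s. len s ^ r) / real n powr (real r * \<phi>)) \<longlonglongrightarrow> limit_moment r"
proof (cases r)
  case 0
  then show ?thesis using lead_moments[of 0] by simp
next
  case (Suc k)
  \<comment> \<open>The factor \<open>r\<close> comes from the difference of powers, and
    \<open>4 ^ k\<close> from \<open>4 * lead\<close> as a common bound for \<open>len\<close> and
    \<open>lead\<close>.\<close>
  define K where "K = real r * 4 ^ k"
  define v where "v n = real n powr (real k * \<phi>)" for n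
  have K: "K \<ge> 0" by (simp add: K_def)
  have pointwise: "\<bar>len s ^ r - lead s ^ r\<bar> \<le> K * (\<bar>decay s\<bar> * lead s ^ k)" for s
  proof -
    have "0 \<le> len s" by (cases s) (simp add: len_def)
    then have "\<bar>len s ^ Suc k - lead s ^ Suc k\<bar> \<le> real (Suc k) * (\<bar>len s - lead s\<bar> * (4 * lead s) ^ k)"
      using len_le_lead[of s] lead_le_len[of s] lead_nonneg[of s] by (intro power_diff_bound) auto
    also have "\<bar>len s - lead s\<bar> \<le> \<bar>decay s\<bar>"
      using c1_bounds mult_right_mono[of "\<bar>1 - c 1\<bar>" 1 "\<bar>decay s\<bar>"]
      by (simp add: len_decomposition abs_mult)
    finally show ?thesis
      using lead_nonneg[of s] by (simp add: Suc K_def power_mult_distrib mult_left_mono mult_right_mono ac_simps)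
  qed
  have bound: "norm (expect n (\<lambda>s. len s ^ r) / real n powr (real r * \<phi>) -
      expect n (\<lambda>s. lead s ^ r) / real n powr (real r * \<phi>)) \<le>
      K * real n powr (1 / 2 - \<phi>) *
        (3 + expect n (\<lambda>s. lead s ^ (2 * k)) / real n powr (real (2 * k) * \<phi>))"
    if n: "n \<ge> 1" for n
  proof -
    define u where "u = real n powr (1 / 2)"
    have pos: "u > 0" "v n > 0" using n by (simp_all add: u_def v_def)
    have u2: "u\<^sup>2 = real n" using n by (simp add: u_def powr_power)
    have v2: "(v n)\<^sup>2 = real n powr (real (2 * k) * \<phi>)"
      using n by (simp add: v_def powr_power mult.assoc)
    \<comment> \<open>Scaled so that both squares have bounded expectation; the prefactor \<open>u * v n\<close> is
      \<open>o(n powr (r * \<phi>))\<close> precisely because \<open>\<phi> > 1 / 2\<close>.\<close>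
    have amgm: "q * p \<le> u * v n * (q\<^sup>2 / u\<^sup>2 + p\<^sup>2 / (v n)\<^sup>2)" for q p :: real
    proof -
      have "2 * ((q / u) * (p / v n)) \<le> (q / u)\<^sup>2 + (p / v n)\<^sup>2"
        using sum_squares_bound[of "q / u" "p / v n"] by (simp add: mult.assoc)
      moreover have "0 \<le> (q / u)\<^sup>2 + (p / v n)\<^sup>2" by simp
      ultimately have "(q / u) * (p / v n) \<le> (q / u)\<^sup>2 + (p / v n)\<^sup>2" by linarith
      then have "u * v n * ((q / u) * (p / v n)) \<le> u * v n * ((q / u)\<^sup>2 + (p / v n)\<^sup>2)"
        using pos by (intro mult_left_mono) auto
      then show ?thesis using pos by (simp add: power_divide)
    qed
    have "\<bar>expect n (\<lambda>s. len s ^ r) - expect n (\<lambda>s. lead s ^ r)\<bar> =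
        \<bar>expect n (\<lambda>s. len s ^ r - lead s ^ r)\<bar>"
      using n by (simp add: integrable_count_law)
    also have "\<dots> \<le> expect n (\<lambda>s. K * (u * v n * (decay s ^ 2 / u\<^sup>2 + lead s ^ (2 * k) / (v n)\<^sup>2)))"
    proof (rule abs_expect_le[OF n])
      fix x y
      have "\<bar>decay (x, y)\<bar> * lead (x, y) ^ k \<le>
          u * v n * (\<bar>decay (x, y)\<bar>\<^sup>2 / u\<^sup>2 + (lead (x, y) ^ k)\<^sup>2 / (v n)\<^sup>2)" by (rule amgm)
      also have "(lead (x, y) ^ k)\<^sup>2 = lead (x, y) ^ (2 * k)" by (simp add: power_even_eq)
      finally show "\<bar>len (x, y) ^ r - lead (x, y) ^ r\<bar> \<le>
          K * (u * v n * (decay (x, y) ^ 2 / u\<^sup>2 + lead (x, y) ^ (2 * k) / (v n)\<^sup>2))"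
        using pointwise[of "(x, y)"] mult_left_mono[OF _ K] by fastforce
    qed
    also have "\<dots> = K * (u * v n * (expect n (\<lambda>s. decay s ^ 2) / u\<^sup>2 + expect n (\<lambda>s. lead s ^ (2 * k)) / (v n)\<^sup>2))"
      using n by (simp add: integrable_count_law)
    also have "\<dots> \<le> K * (u * v n * (3 + expect n (\<lambda>s. lead s ^ (2 * k)) / (v n)\<^sup>2))"
    proof -
      obtain m where m: "n = Suc m" using n by (cases n) auto
      have "expect n (\<lambda>s. decay s ^ 2) \<le> 3 * real n" using expect_decay_square[of m] by (simp add: m)
      then have "expect n (\<lambda>s. decay s ^ 2) / u\<^sup>2 \<le> 3" using n unfolding u2 by (simp add: divide_le_eq)
      then show ?thesis using pos K by (intro mult_left_mono add_right_mono) auto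
    qed
    finally have main: "\<bar>expect n (\<lambda>s. len s ^ r) - expect n (\<lambda>s. lead s ^ r)\<bar> \<le>
        K * (u * v n * (3 + expect n (\<lambda>s. lead s ^ (2 * k)) / real n powr (real (2 * k) * \<phi>)))"
      unfolding v2 .
    have vr: "real n powr (real r * \<phi>) = v n * real n powr \<phi>"
      unfolding v_def powr_add[symmetric] Suc by (simp add: algebra_simps)
    have "norm (expect n (\<lambda>s. len s ^ r) / real n powr (real r * \<phi>) -
        expect n (\<lambda>s. lead s ^ r) / real n powr (real r * \<phi>)) =
        \<bar>expect n (\<lambda>s. len s ^ r) - expect n (\<lambda>s. lead s ^ r)\<bar> / real n powr (real r * \<phi>)"
      by (simp add: diff_divide_distrib[symmetric] abs_divide)
    also have "\<dots> \<le> K * (u * v n * (3 + expect n (\<lambda>s. lead s ^ (2 * k)) / real n powr (real (2 * k) * \<phi>)))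
        / real n powr (real r * \<phi>)"
      using main by (intro divide_right_mono) auto
    also have "\<dots> = K * (u / real n powr \<phi>) * (3 + expect n (\<lambda>s. lead s ^ (2 * k)) / real n powr (real (2 * k) * \<phi>))"
      unfolding vr using pos by simp
    also have "u / real n powr \<phi> = real n powr (1 / 2 - \<phi>)"
      using n by (simp add: u_def powr_diff)
    finally show ?thesis .
  qed
  have "(\<lambda>n. real n powr (1 / 2 - \<phi>)) \<longlonglongrightarrow> 0"
    using phi_bounds by real_asymp
  then have "(\<lambda>n. K * real n powr (1 / 2 - \<phi>) *
      (3 + expect n (\<lambda>s. lead s ^ (2 * k)) / real n powr (real (2 * k) * \<phi>)))
      \<longlonglongrightarrow> K * 0 * (3 + limit_moment (2 * k))"
    by (intro tendsto_mult tendsto_add tendsto_const lead_moments)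
  then have "(\<lambda>n. expect n (\<lambda>s. len s ^ r) / real n powr (real r * \<phi>) -
      expect n (\<lambda>s. lead s ^ r) / real n powr (real r * \<phi>)) \<longlonglongrightarrow> 0"
    by (intro Lim_null_comparison[OF eventually_mono[OF eventually_ge_at_top[of 1] bound]]) simp_all
  from tendsto_add[OF this lead_moments[of r]] show ?thesis by simp
qed

text \<open>The factorials cancel, \<open>c (2 * k)\<close> is at most \<open>4 ^ k\<close>, and
  \<open>2 * \<phi> > 1\<close> puts the Gamma value above \<open>fact k\<close>. The terms are thus
  dominated by those of an exponential series.\<close>

lemma limit_moment_growth: "(\<lambda>k. t ^ (2 * k) / fact (2 * k) * limit_moment (2 * k)) \<longlonglongrightarrow> 0"
proof (rule Lim_null_comparison)
  show "(\<lambda>k. inverse (fact k) * (4 * t\<^sup>2) ^ k) \<longlonglongrightarrow> 0"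
    by (rule summable_LIMSEQ_zero[OF summable_exp])
  show "\<forall>\<^sub>F k in sequentially. norm (t ^ (2 * k) / fact (2 * k) * limit_moment (2 * k)) \<le>
      inverse (fact k) * (4 * t\<^sup>2) ^ k"
    using eventually_ge_at_top[of 1]
  proof eventually_elim
    case (elim k)
    have "real k * 1 < real k * (2 * \<phi>)"
      using elim phi_bounds by (intro mult_strict_left_mono) auto
    then have "1 + real k < real (2 * k) * \<phi> + 1" by simp
    \<comment> \<open>For \<open>k \<ge> 1\<close> both arguments are at least 2, where Gamma is
      increasing.\<close>
    then have "Gamma (1 + real k) < Gamma (real (2 * k) * \<phi> + 1)"
      using elim by (intro Gamma_real_strict_mono) auto
    then have G: "fact k \<le> Gamma (real (2 * k) * \<phi> + 1)" by (simp add: Gamma_fact)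
    have G0: "0 < Gamma (real (2 * k) * \<phi> + 1)"
      using phi_bounds by (intro Gamma_real_pos add_nonneg_pos) auto
    have "norm (t ^ (2 * k) / fact (2 * k) * limit_moment (2 * k)) =
        (t\<^sup>2) ^ k * c (2 * k) / Gamma (real (2 * k) * \<phi> + 1)"
      using G0 c_nonneg[of "2 * k"] by (simp add: abs_mult power_mult)
    also have "\<dots> \<le> (t\<^sup>2) ^ k * 2 ^ (2 * k) / fact k"
      using G G0 c_bound[of "2 * k"] c_nonneg[of "2 * k"]
      by (intro frac_le mult_left_mono mult_nonneg_nonneg) auto
    also have "\<dots> = inverse (fact k) * (4 * t\<^sup>2) ^ k"
      by (simp add: power_mult power_mult_distrib divide_inverse)
    finally show ?case .
  qed
qed

text \<open>The dummy size 0 inherits finite support from size 1, so all powers are integrable for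
  every \<open>n\<close>, as \<open>method_of_moments\<close> asks.\<close>

lemma path_length_0: "path_length 0 = path_length (Suc 0)"
  by (simp add: path_length_def)

lemma finite_path_length: "finite (set_pmf (path_length n))"
proof -
  have "finite (set_pmf (path_length n))" if "n \<ge> 1" for n
    using finite_count_law[OF that] by (simp add: path_length_eq)
  then show ?thesis using path_length_0 by (cases n) auto
qed

lemma expectation_path_length:
  "measure_pmf.expectation (path_length n) (\<lambda>l. f (real l)) = expect n (\<lambda>s. f (len s))"
  by (simp add: path_length_eq len_def case_prod_beta)

lemma scaled_length_moments:
  "(\<lambda>n. \<integral>x. x ^ r \<partial>distr (measure_pmf (path_length n)) borel (\<lambda>l. real l / real n powr \<phi>))
    \<longlonglongrightarrow> limit_moment r"
proof (rule Lim_transform_eventually[OF len_moments])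
  show "\<forall>\<^sub>F n in sequentially. expect n (\<lambda>s. len s ^ r) / real n powr (real r * \<phi>) =
      (\<integral>x. x ^ r \<partial>distr (measure_pmf (path_length n)) borel (\<lambda>l. real l / real n powr \<phi>))"
    using eventually_gt_at_top[of 0]
  proof eventually_elim
    case (elim n)
    have "(\<integral>x. x ^ r \<partial>distr (measure_pmf (path_length n)) borel (\<lambda>l. real l / real n powr \<phi>)) =
        measure_pmf.expectation (path_length n) (\<lambda>l. (real l / real n powr \<phi>) ^ r)"
      by (rule integral_distr) simp_all
    also have "\<dots> = expect n (\<lambda>s. (len s / real n powr \<phi>) ^ r)"
      by (rule expectation_path_length)
    also have "\<dots> = expect n (\<lambda>s. len s ^ r) / real n powr (real r * \<phi>)"
      using elim by (simp add: power_divide powr_power)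
    finally show ?case by simp
  qed
qed

section \<open>The exact mean\<close>

lemma generator_lead: "generator lead s = \<phi> * lead s"
proof -
  have "eig (Suc 0) = lead"
    by (rule ext) (use eig_recursion[of "Suc 0"] lin_1 in \<open>simp add: eig_0\<close>)
  then show ?thesis using generator_eig[of "Suc 0" s] by simp
qed

lemma generator_decay: "generator decay s = - (1 + \<phi>) * decay s"
proof -
  obtain x y where s: "s = (x, y)" by force
  have 1: "real x * (decay (x - 1, y + 1) - decay (x, y)) = real x * (- 1 - \<phi>)"
    by (cases x) (simp_all add: decay_def algebra_simps)
  have "(1 + \<phi>) * \<phi> = 1" using phi_square by (simp add: algebra_simps)
  then have "(1 + \<phi>) * (\<phi> * real y) = real y" by (simp flip: mult.assoc)
  then show ?thesis unfolding s generator_def using 1 by (simp add: decay_def algebra_simps)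
qed

lemma c_1_closed_form: "c 1 = (1 + sqrt 5) / (2 * sqrt 5)"
proof -
  have "c 1 * (2 * sqrt 5) = 1 + sqrt 5" by (simp add: c_1 \<phi>_def field_simps)
  then show ?thesis by (simp add: field_simps)
qed

lemma expectation_path_length_exact:
  assumes n: "n \<ge> 1"
  shows "measure_pmf.expectation (path_length n) real =
    real n * ((3 + sqrt 5) / (2 * sqrt 5) * ((real n + sqrt 5 / 2 - 3 / 2) gchoose n)
              - (3 - sqrt 5) / (2 * sqrt 5) * ((real n - sqrt 5 / 2 - 3 / 2) gchoose n))"
proof -
  obtain m where m: "n = Suc m" using n by (cases n) auto
  have "measure_pmf.expectation (path_length n) real = expect n len"
    using expectation_path_length[of n "\<lambda>x. x"] by simp
  also have "len = (\<lambda>s. lead s + (1 - c 1) * decay s)"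
    by (rule ext) (rule len_decomposition)
  also have "expect n (\<lambda>s. lead s + (1 - c 1) * decay s) = expect n lead + (1 - c 1) * expect n decay"
    using n by (simp add: integrable_count_law)
  also have "expect n lead = c 1 * pochhammer (1 + \<phi>) m / fact m"
    unfolding m by (subst expect_eigenfunction[OF generator_lead]) (simp add: lead_def)
  also have "expect n decay = pochhammer (- \<phi>) m / fact m"
    unfolding m by (subst expect_eigenfunction[OF generator_decay]) (simp add: decay_def)
  finally have lhs: "measure_pmf.expectation (path_length n) real =
      c 1 * (pochhammer (1 + \<phi>) m / fact m) + (1 - c 1) * (pochhammer (- \<phi>) m / fact m)" by simp
  \<comment> \<open>The first factor \<open>a\<close> of the rising factorial splits off, and the
    \<open>n\<close> in front reduces \<open>fact n\<close> to \<open>fact m\<close>. The cases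
    needed are \<open>a = \<phi>\<close> and \<open>a = - 1 - \<phi>\<close>.\<close>
  have binom: "real n * ((real n + a - 1) gchoose n) = a * (pochhammer (a + 1) m / fact m)" for a
    unfolding gbinomial_pochhammer' m by (simp add: pochhammer_rec del: of_nat_Suc)
  have a: "real n + sqrt 5 / 2 - 3 / 2 = real n + \<phi> - 1"
    and b: "real n - sqrt 5 / 2 - 3 / 2 = real n + (- 1 - \<phi>) - 1"
    by (simp_all add: \<phi>_def field_simps)
  define X where "X = (3 + sqrt 5) / (2 * sqrt 5)"
  define Y where "Y = (3 - sqrt 5) / (2 * sqrt 5)"
  have A: "X * \<phi> = c 1" and B: "Y * (- 1 - \<phi>) = - (1 - c 1)"
    unfolding X_def Y_def c_1_closed_form \<phi>_def by (simp_all add: field_simps)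
  have "real n * (X * ((real n + \<phi> - 1) gchoose n) - Y * ((real n + (- 1 - \<phi>) - 1) gchoose n)) =
      X * (real n * ((real n + \<phi> - 1) gchoose n)) - Y * (real n * ((real n + (- 1 - \<phi>) - 1) gchoose n))"
    by (simp add: algebra_simps)
  also have "\<dots> = (X * \<phi>) * (pochhammer (1 + \<phi>) m / fact m) - (Y * (- 1 - \<phi>)) * (pochhammer (- \<phi>) m / fact m)"
    unfolding binom by (simp add: add.commute)
  also have "\<dots> = measure_pmf.expectation (path_length n) real"
    unfolding A B lhs by (simp only: mult_minus_left diff_minus_eq_add)
  finally show ?thesis
    unfolding a b X_def[symmetric] Y_def[symmetric] by (rule sym)
qed

theorem theorem5:
  shows
    "(\<forall>n\<ge>1. measure_pmf.expectation (path_length n) real =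
        real n * ((3 + sqrt 5) / (2 * sqrt 5) * ((real n + sqrt 5 / 2 - 3 / 2) gchoose n)
                  - (3 - sqrt 5) / (2 * sqrt 5) * ((real n - sqrt 5 / 2 - 3 / 2) gchoose n)))
     \<and> (\<lambda>n. measure_pmf.expectation (path_length n) real)
         \<sim>[at_top] (\<lambda>n. (1 + sqrt 5) / (2 * sqrt 5) * (real n powr \<phi> / Gamma (\<phi> + 1)))
     \<and> (\<exists>L. real_distribution L
          \<and> weak_conv_m (\<lambda>n. distr (measure_pmf (path_length n)) borel (\<lambda>l. real l / real n powr \<phi>)) L
          \<and> (\<forall>r. has_bochner_integral L (\<lambda>x. x ^ r) (fact r * c r / Gamma (real r * \<phi> + 1)))
          \<and> (\<forall>L'. real_distribution L'
                \<and> (\<forall>r. has_bochner_integral L' (\<lambda>x. x ^ r) (fact r * c r / Gamma (real r * \<phi> + 1)))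
                \<longrightarrow> L' = L))"
proof (intro conjI)
  show "\<forall>n\<ge>1. measure_pmf.expectation (path_length n) real =
        real n * ((3 + sqrt 5) / (2 * sqrt 5) * ((real n + sqrt 5 / 2 - 3 / 2) gchoose n)
                  - (3 - sqrt 5) / (2 * sqrt 5) * ((real n - sqrt 5 / 2 - 3 / 2) gchoose n))"
    using expectation_path_length_exact by blast
next
  have "Gamma (\<phi> + 1) > 0" using phi_bounds by (intro Gamma_real_pos) auto
  moreover have "(\<lambda>n. measure_pmf.expectation (path_length n) real / real n powr \<phi>)
      \<longlonglongrightarrow> c 1 / Gamma (\<phi> + 1)"
    using len_moments[of 1] expectation_path_length[of _ "\<lambda>x. x"] by simp
  \<comment> \<open>The limit of the ratio is nonzero, as asymptotic equivalence requires, because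
    \<open>c 1\<close> and the Gamma value are positive.\<close>
  ultimately have "(\<lambda>n. measure_pmf.expectation (path_length n) real)
      \<sim>[at_top] (\<lambda>n. c 1 / Gamma (\<phi> + 1) * real n powr \<phi>)"
    using c1_bounds by (intro asymp_equivI'_const) auto
  then show "(\<lambda>n. measure_pmf.expectation (path_length n) real)
      \<sim>[at_top] (\<lambda>n. (1 + sqrt 5) / (2 * sqrt 5) * (real n powr \<phi> / Gamma (\<phi> + 1)))"
    unfolding c_1_closed_form by simp
next
  let ?M = "\<lambda>n. distr (measure_pmf (path_length n)) borel (\<lambda>l. real l / real n powr \<phi>)"
  have M: "real_distribution (?M n)" for n
    by (rule prob_space.real_distribution_distr[OF prob_space_measure_pmf]) simp
  have int: "integrable (?M n) (\<lambda>x. x ^ r)" for n r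
    using finite_path_length by (simp add: integrable_distr_eq integrable_measure_pmf_finite)
  obtain L where "real_distribution L" "weak_conv_m ?M L"
    "\<And>r. has_bochner_integral L (\<lambda>x. x ^ r) (limit_moment r)"
    using method_of_moments[OF M int scaled_length_moments limit_moment_growth] by blast
  then show "\<exists>L. real_distribution L
          \<and> weak_conv_m ?M L
          \<and> (\<forall>r. has_bochner_integral L (\<lambda>x. x ^ r) (fact r * c r / Gamma (real r * \<phi> + 1)))
          \<and> (\<forall>L'. real_distribution L'
                \<and> (\<forall>r. has_bochner_integral L' (\<lambda>x. x ^ r) (fact r * c r / Gamma (real r * \<phi> + 1)))
                \<longrightarrow> L' = L)"
    using moments_determine_distribution[OF _ _ _ _ limit_moment_growth] by blast
qed

end
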